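(* Let $n\ge3$ and let $V\in\mathcal{K}_n$. Then there exists $\delta>0$ (depending only on $n$ and $V$) such that, whenever $u\in W^{2,2}(\mathbb{R}^n)$ is a nontrivial (i.e. not almost everywhere zero) solution of $|\Delta u(x)|\le|V(x)u(x)|$ for a.e. $x\in\mathbb{R}^n$ whose support is contained in a ball $B(a,r)$, with $a\in\mathbb{R}^n$ and $r>0$, the Lebesgue measure of the ball satisfies $|B(a,r)|\ge\delta$.
   Context: $W^{m,p}(\mathbb{R}^n)$ is the Sobolev space of (complex-valued) functions whose derivatives up to order $m$ belong to $L^p(\mathbb{R}^n)$. $B(x,r)$ is the open ball of radius $r$ centered at $x$. The Kato class $\mathcal{K}_n$ consists of all (complex-valued) $V\in L^1_{\mathrm{loc}}(\mathbb{R}^n)$ with $$\lim_{r\to0}\ \sup_{x\in\mathbb{R}^n}\int_{|x-y|<r}\frac{|V(y)|}{|x-y|^{n-2}}\,dy=0.$$ *)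

theory Defs
  imports "HOL-Analysis.Analysis"
begin

definition partial_deriv :: "'n \<Rightarrow> (real ^ 'n::finite \<Rightarrow> complex) \<Rightarrow> real ^ 'n \<Rightarrow> complex" where
  "partial_deriv i f x = vector_derivative (\<lambda>t. f (x + t *\<^sub>R axis i 1)) (at 0)"

text \<open>
  Partial derivatives of order \<open>m\<close> are indexed by lists of \<open>m\<close> coordinate directions rather than
  by multi-indices; on smooth functions the order of the directions is irrelevant.
\<close>

primrec partial_derivs :: "'n list \<Rightarrow> (real ^ 'n::finite \<Rightarrow> complex) \<Rightarrow> real ^ 'n \<Rightarrow> complex" where
  "partial_derivs [] f = f"
| "partial_derivs (i # is) f = partial_deriv i (partial_derivs is f)"

definition smooth :: "(real ^ 'n::finite \<Rightarrow> complex) \<Rightarrow> bool" where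
  "smooth f \<longleftrightarrow>
     (\<forall>is. continuous_on UNIV (partial_derivs is f) \<and>
           (\<forall>i x. (\<lambda>t. partial_derivs is f (x + t *\<^sub>R axis i 1)) differentiable (at 0)))"

definition test_functions :: "(real ^ 'n::finite \<Rightarrow> complex) set" where
  "test_functions = {\<phi>. smooth \<phi> \<and> compact (closure {x. \<phi> x \<noteq> 0})}"

definition locally_integrable :: "(real ^ 'n::finite \<Rightarrow> complex) \<Rightarrow> bool" where
  "locally_integrable f \<longleftrightarrow> (\<forall>K. compact K \<longrightarrow> f absolutely_integrable_on K)"

definition has_weak_deriv ::
    "(real ^ 'n::finite \<Rightarrow> complex) \<Rightarrow> 'n list \<Rightarrow> (real ^ 'n \<Rightarrow> complex) \<Rightarrow> bool" where
  "has_weak_deriv u is w \<longleftrightarrow>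
     locally_integrable u \<and> locally_integrable w \<and>
     (\<forall>\<phi>\<in>test_functions.
        (LINT x|lebesgue. u x * partial_derivs is \<phi> x) =
        (- 1) ^ length is * (LINT x|lebesgue. w x * \<phi> x))"

text \<open>Meant for real exponents \<open>p \<ge> 1\<close>; elements are functions, not classes modulo null sets.\<close>

definition Lp_space :: "real \<Rightarrow> (real ^ 'n::finite \<Rightarrow> complex) set" where
  "Lp_space p =
     {f. f \<in> borel_measurable lebesgue \<and> integrable lebesgue (\<lambda>x. norm (f x) powr p)}"

definition sobolev_space :: "nat \<Rightarrow> real \<Rightarrow> (real ^ 'n::finite \<Rightarrow> complex) set" where
  "sobolev_space m p =
     {u \<in> Lp_space p. \<forall>is. length is \<le> m \<longrightarrow> (\<exists>w\<in>Lp_space p. has_weak_deriv u is w)}"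

text \<open>
  A representative of the weak derivative, which is unique up to null sets. It is arbitrary
  if the weak derivative does not exist, so it is only meaningful for suitable \<open>u\<close>.
\<close>

definition weak_deriv :: "'n list \<Rightarrow> (real ^ 'n::finite \<Rightarrow> complex) \<Rightarrow> real ^ 'n \<Rightarrow> complex" where
  "weak_deriv is u = (SOME w. has_weak_deriv u is w)"

definition weak_laplacian :: "(real ^ 'n::finite \<Rightarrow> complex) \<Rightarrow> real ^ 'n \<Rightarrow> complex" where
  "weak_laplacian u x = (\<Sum>i\<in>UNIV. weak_deriv [i, i] u x)"

text \<open>
  The support of a function regarded as defined only almost everywhere: the complement of the
  largest open set on which it vanishes almost everywhere.
\<close>

definition ess_support :: "(real ^ 'n::finite \<Rightarrow> complex) \<Rightarrow> (real ^ 'n) set" where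
  "ess_support u = - \<Union>{U. open U \<and> (AE x in lebesgue. x \<in> U \<longrightarrow> u x = 0)}"

text \<open>
  Integral and supremum are taken in \<^typ>\<open>ennreal\<close>, so that they may be infinite. The exponent
  uses truncated subtraction: the definition is meant for dimension at least 2.
\<close>

definition kato_class :: "(real ^ 'n::finite \<Rightarrow> complex) set" where
  "kato_class =
     {V. locally_integrable V \<and>
         ((\<lambda>r::real. SUP x. \<integral>\<^sup>+ y\<in>ball x r.
              ennreal (norm (V y) / norm (x - y) ^ (CARD('n) - 2)) \<partial>lebesgue) \<longlongrightarrow> 0) (at_right 0)}"

end

theory Submission
  imports Defs
begin

text \<open>
  Write \<open>f = \<Delta>u\<close> and \<open>B = B(a, r)\<close>. Outside \<open>B\<close> both \<open>u\<close> and, by the differential inequality, \<open>f\<close>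
  vanish, so \<open>u\<close> is a multiple of the Newtonian potential of \<open>f\<close>, whence
  \<open>c |u(x)| \<le> \<integral> |f(y)| |x - y|\<^sup>2\<^sup>-\<^sup>n dy\<close>. Multiplying by \<open>|V|\<close>, integrating over \<open>B\<close> and exchanging the
  integrals gives
  \<open>c \<integral> |f| \<le> c \<integral>\<^sub>B |V u| \<le> sup\<^sub>y \<integral>\<^sub>B |V(x)| |x - y|\<^sup>2\<^sup>-\<^sup>n dx \<cdot> \<integral> |f|\<close>.
  The Kato condition makes the supremum smaller than \<open>c\<close> if \<open>r\<close> is small, and then \<open>f = 0\<close> and \<open>u = 0\<close>.

  For the potential representation, the weak equation is tested with
  \<open>(|y - x|\<^sup>2 + e\<^sup>2)\<close> to the power \<open>1 - n/2\<close>, cut off outside \<open>B\<close>. Its Laplacian is a negative multiple of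
  an integrable kernel that concentrates at \<open>x\<close> as \<open>e \<rightarrow> 0\<close>. Since only averages over boxes are
  compared in this limit, dominated convergence suffices and no Lebesgue points are needed.
\<close>

section \<open>Smooth cutoffs\<close>

text \<open>The scale \<open>k\<close> makes the family closed under differentiation.\<close>

definition flat :: "nat \<Rightarrow> real \<Rightarrow> real" where
  "flat k t = (if t > 0 then exp (- 1 / t) / t ^ k else 0)"

lemma flat_nonneg: "flat k t \<ge> 0"
  by (simp add: flat_def)

lemma flat_pos: "t > 0 \<Longrightarrow> flat k t > 0"
  by (simp add: flat_def)

lemma flat_eq_0: "t \<le> 0 \<Longrightarrow> flat k t = 0"
  by (simp add: flat_def)

text \<open>Under t = 1/x this is the decay of x^k / exp x at infinity. All \<open>k\<close> are
  needed because the difference quotient of \<open>flat k\<close> at 0 is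
  \<open>flat (Suc k)\<close>.\<close>

lemma flat_tendsto_0: "(flat k \<longlongrightarrow> 0) (at 0)"
proof -
  have "((\<lambda>x::real. x ^ k / exp x) \<longlongrightarrow> 0) at_top"
    by (rule tendsto_power_div_exp_0)
  then have "((\<lambda>t::real. inverse t ^ k / exp (inverse t)) \<longlongrightarrow> 0) (at_right 0)"
    by (rule filterlim_compose[OF _ filterlim_inverse_at_top_right])
  then have right: "(flat k \<longlongrightarrow> 0) (at_right 0)"
    by (rule Lim_transform_eventually)
      (auto simp: eventually_at_right_less flat_def exp_minus field_simps
        intro!: eventually_mono[OF eventually_at_right_less])
  have "(flat k \<longlongrightarrow> 0) (at_left 0)"
    by (rule Lim_transform_eventually[OF tendsto_const])
      (auto simp: flat_def eventually_at_left_field intro!: exI[of _ "-1"])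
  with right show ?thesis
    by (simp add: filterlim_at_split)
qed

lemma has_real_derivative_flat:
  "(flat k has_real_derivative (flat (k + 2) t - real k * flat (Suc k) t)) (at t)"
proof (cases t "0 :: real" rule: linorder_cases)
  case less
  have "(flat k has_real_derivative 0) (at t)"
    by (rule has_field_derivative_transform_within_open[of "\<lambda>_. 0" _ _ "{..<0}"])
      (use less in \<open>auto simp: flat_eq_0\<close>)
  then show ?thesis
    using less by (simp add: flat_eq_0)
next
  case equal
  have "((\<lambda>h. (flat k (0 + h) - flat k 0) / h) \<longlongrightarrow> 0) (at 0)"
    by (rule Lim_transform_eventually[OF flat_tendsto_0[of "Suc k"]])
      (auto simp: flat_def eventually_at_filter)
  then show ?thesis
    using equal by (simp add: DERIV_def flat_eq_0)
next
  case greater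
  have "((\<lambda>t. exp (- 1 / t) / t ^ k) has_real_derivative
      (flat (k + 2) t - real k * flat (Suc k) t)) (at t)"
  \<comment> \<open>The power rule involves the exponent k - 1, which truncates at k = 0.\<close>
  proof (cases k)
    case 0
    then show ?thesis
      using greater
      by (auto intro!: derivative_eq_intros simp: flat_def field_simps power2_eq_square)
  next
    case (Suc m)
    have "((\<lambda>t. exp (- 1 / t) / t ^ Suc m) has_real_derivative
        (exp (- 1 / t) / t\<^sup>2 * t ^ Suc m - exp (- 1 / t) * (real (Suc m) * t ^ m)) /
        (t ^ Suc m * t ^ Suc m)) (at t)"
      using greater by (auto intro!: derivative_eq_intros simp: power2_eq_square simp del: power_Suc)
    moreover have "(exp (- 1 / t) / t\<^sup>2 * t ^ Suc m - exp (- 1 / t) * (real (Suc m) * t ^ m)) /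
        (t ^ Suc m * t ^ Suc m) = flat (k + 2) t - real k * flat (Suc k) t"
      using greater Suc by (simp add: flat_def divide_simps power2_eq_square) (simp add: algebra_simps)
    ultimately show ?thesis
      using Suc by simp
  qed
  then show ?thesis
    by (rule has_field_derivative_transform_within_open[of _ _ _ "{0<..}"])
      (use greater in \<open>auto simp: flat_def\<close>)
qed

lemma continuous_on_flat: "continuous_on S (flat k)"
  by (meson DERIV_isCont continuous_at_imp_continuous_on has_real_derivative_flat)

text \<open>
  A class of smooth functions that contains cutoffs and is closed under directional derivatives; the
  latter turns smoothness into continuity and differentiability of every member of the class.
\<close>

inductive elementary :: "(real ^ 'n::finite \<Rightarrow> real) \<Rightarrow> bool" where
  const: "elementary (\<lambda>x. c)"
| component: "elementary (\<lambda>x. x $ i)"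
| add: "elementary f \<Longrightarrow> elementary g \<Longrightarrow> elementary (\<lambda>x. f x + g x)"
| mult: "elementary f \<Longrightarrow> elementary g \<Longrightarrow> elementary (\<lambda>x. f x * g x)"
| flat: "elementary f \<Longrightarrow> elementary (\<lambda>x. flat k (f x))"
| powr: "elementary f \<Longrightarrow> (\<And>x. f x > 0) \<Longrightarrow> elementary (\<lambda>x. f x powr a)"

lemma elementary_continuous: "elementary f \<Longrightarrow> continuous_on S f"
proof (induction rule: elementary.induct)
  case (flat f k)
  show ?case
    by (rule continuous_on_compose2[OF continuous_on_flat flat.IH]) auto
next
  case (powr f a)
  then show ?case
    by (auto intro!: continuous_intros simp: less_imp_neq[symmetric] dest: less_imp_neq)
qed (auto intro!: continuous_intros)

text \<open>Each constructor has a derivative built from the constructors again: differentiating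
  \<open>flat k\<close> raises \<open>k\<close>, differentiating a power lowers \<open>a\<close>,
  and the everywhere positive base makes the power rule valid at every point.\<close>

lemma elementary_derivative:
  assumes "elementary f"
  shows "\<exists>g. elementary g \<and> (\<forall>x. ((\<lambda>t. f (x + t *\<^sub>R axis i 1)) has_real_derivative g x) (at 0))"
  using assms
proof (induction rule: elementary.induct)
  case (const c)
  show ?case
    by (rule exI[of _ "\<lambda>x. 0"]) (auto intro: elementary.intros)
next
  case (component j)
  show ?case
    by (rule exI[of _ "\<lambda>x. axis i 1 $ j"])
      (auto intro!: elementary.intros derivative_eq_intros)
next
  case (add f g)
  then obtain f' g' where "elementary f'" "elementary g'"
    "\<And>x. ((\<lambda>t. f (x + t *\<^sub>R axis i 1)) has_real_derivative f' x) (at 0)"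
    "\<And>x. ((\<lambda>t. g (x + t *\<^sub>R axis i 1)) has_real_derivative g' x) (at 0)"
    by blast
  then show ?case
    by (intro exI[of _ "\<lambda>x. f' x + g' x"] conjI elementary.add allI DERIV_add)
next
  case (mult f g)
  then obtain f' g' where "elementary f'" "elementary g'"
    "\<And>x. ((\<lambda>t. f (x + t *\<^sub>R axis i 1)) has_real_derivative f' x) (at 0)"
    "\<And>x. ((\<lambda>t. g (x + t *\<^sub>R axis i 1)) has_real_derivative g' x) (at 0)"
    by blast
  moreover from this have "((\<lambda>t. f (x + t *\<^sub>R axis i 1) * g (x + t *\<^sub>R axis i 1))
      has_real_derivative (f' x * g x + g' x * f x)) (at 0)" for x
    using DERIV_mult[of "\<lambda>t. f (x + t *\<^sub>R axis i 1)" _ 0 UNIV "\<lambda>t. g (x + t *\<^sub>R axis i 1)"]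
    by fastforce
  ultimately show ?case
    using mult.hyps
    by (intro exI[of _ "\<lambda>x. f' x * g x + g' x * f x"] conjI elementary.add elementary.mult allI)
next
  case (flat f k)
  then obtain f' where f': "elementary f'"
    "\<And>x. ((\<lambda>t. f (x + t *\<^sub>R axis i 1)) has_real_derivative f' x) (at 0)"
    by blast
  let ?g = "\<lambda>x. (flat (k + 2) (f x) + (- real k) * flat (Suc k) (f x)) * f' x"
  have "((\<lambda>t. flat k (f (x + t *\<^sub>R axis i 1))) has_real_derivative ?g x) (at 0)" for x
    using DERIV_chain2[OF has_real_derivative_flat f'(2)[of x], of k] by simp
  moreover have "elementary ?g"
    by (intro elementary.intros flat.hyps f')
  ultimately show ?case
    by blast
next
  case (powr f a)
  then obtain f' where f': "elementary f'"
    "\<And>x. ((\<lambda>t. f (x + t *\<^sub>R axis i 1)) has_real_derivative f' x) (at 0)"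
    by blast
  let ?g = "\<lambda>x. (a * f x powr (a - 1)) * f' x"
  have "((\<lambda>t. f (x + t *\<^sub>R axis i 1) powr a) has_real_derivative ?g x) (at 0)" for x
    using DERIV_chain2[OF has_real_derivative_powr f'(2)[of x], of a] powr.hyps(2)[of x] by simp
  moreover have "elementary ?g"
    by (intro elementary.intros powr.hyps f')
  ultimately show ?case
    by blast
qed

lemma partial_deriv_of_real:
  assumes "((\<lambda>t. f (x + t *\<^sub>R axis i 1)) has_real_derivative d) (at 0)"
  shows "((\<lambda>t. complex_of_real (f (x + t *\<^sub>R axis i 1))) has_vector_derivative of_real d) (at 0)"
    and "partial_deriv i (\<lambda>y. complex_of_real (f y)) x = of_real d"
proof -
  show "((\<lambda>t. complex_of_real (f (x + t *\<^sub>R axis i 1))) has_vector_derivative of_real d) (at 0)"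
    using assms by (simp add: has_vector_derivative_of_real has_real_derivative_iff_has_vector_derivative)
  then show "partial_deriv i (\<lambda>y. complex_of_real (f y)) x = of_real d"
    unfolding partial_deriv_def by (rule vector_derivative_at)
qed

lemma elementary_partial_derivs:
  assumes "elementary f"
  shows "\<exists>g. elementary g \<and> partial_derivs is (\<lambda>x. complex_of_real (f x)) = (\<lambda>x. of_real (g x))"
proof (induction "is")
  case Nil
  show ?case
    using assms by auto
next
  case (Cons i "is")
  then obtain g where g: "elementary g"
    "partial_derivs is (\<lambda>x. complex_of_real (f x)) = (\<lambda>x. of_real (g x))"
    by blast
  from elementary_derivative[OF g(1), of i] obtain g' where "elementary g'"
    "\<And>x. ((\<lambda>t. g (x + t *\<^sub>R axis i 1)) has_real_derivative g' x) (at 0)"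
    by blast
  then show ?case
    by (intro exI[of _ g']) (auto simp: g(2) partial_deriv_of_real(2))
qed

lemma elementary_smooth:
  assumes "elementary f"
  shows "smooth (\<lambda>x. complex_of_real (f x))"
  unfolding smooth_def
proof safe
  fix "is"
  obtain g where g: "elementary g"
    "partial_derivs is (\<lambda>x. complex_of_real (f x)) = (\<lambda>x. of_real (g x))"
    using elementary_partial_derivs[OF assms] by blast
  show "continuous_on UNIV (partial_derivs is (\<lambda>x. complex_of_real (f x)))"
    unfolding g(2) by (intro continuous_intros elementary_continuous g)
  fix i x
  obtain g' where "((\<lambda>t. g (x + t *\<^sub>R axis i 1)) has_real_derivative g' x) (at 0)"
    using elementary_derivative[OF g(1)] by blast
  then show "(\<lambda>t. partial_derivs is (\<lambda>x. complex_of_real (f x)) (x + t *\<^sub>R axis i 1))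
      differentiable at 0"
    unfolding g(2) by (rule differentiableI_vector[OF partial_deriv_of_real(1)])
qed

section \<open>Locality of derivatives and cutoff functions\<close>

lemma partial_deriv_eq_on_open:
  assumes "open S" "x \<in> S" "\<And>y. y \<in> S \<Longrightarrow> f y = g y"
  shows "partial_deriv i f x = partial_deriv i g x"
proof -
  have "open ((\<lambda>t. x + t *\<^sub>R axis i 1) -` S)"
    by (intro continuous_open_vimage assms(1) continuous_intros)
  then have "eventually (\<lambda>t. t \<in> (\<lambda>t. x + t *\<^sub>R axis i 1) -` S) (nhds (0 :: real))"
    using assms(2) by (intro eventually_nhds_in_open) auto
  then have "eventually (\<lambda>t. f (x + t *\<^sub>R axis i 1) = g (x + t *\<^sub>R axis i 1)) (nhds (0 :: real))"
    by eventually_elim (auto simp: assms(3))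
  then show ?thesis
    unfolding partial_deriv_def by (intro vector_derivative_cong_eq) auto
qed

text \<open>Iterated derivatives are local. Hence a test function that agrees with a kernel only on
  a ball may replace it there in all derivatives too.\<close>

lemma partial_derivs_eq_on_open:
  assumes "open S" "x \<in> S" "\<And>y. y \<in> S \<Longrightarrow> f y = g y"
  shows "partial_derivs is f x = partial_derivs is g x"
  using assms(2)
proof (induction "is" arbitrary: x)
  case (Cons i "is")
  then show ?case
    by (auto intro: partial_deriv_eq_on_open[OF assms(1)])
qed (auto simp: assms)

lemma elementary_norm_diff:
  fixes z :: "real ^ 'n::finite"
  shows "elementary (\<lambda>y. (norm (y - z))\<^sup>2)"
proof -
  \<comment> \<open>Only binary sums are available in \<open>elementary\<close>, so the coordinate
    sum is built by induction. Subtraction is written as adding a constant to fit the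
    constructors.\<close>
  have sum: "elementary (\<lambda>y :: real ^ 'n. \<Sum>i\<in>A. (y $ i + - z $ i) * (y $ i + - z $ i))" if "finite A" for A
    using that
  proof (induction A rule: finite_induct)
    case empty
    show ?case using elementary.const[of 0] by simp
  next
    case (insert j A)
    then have "elementary (\<lambda>y :: real ^ 'n. (y $ j + - z $ j) * (y $ j + - z $ j)
        + (\<Sum>i\<in>A. (y $ i + - z $ i) * (y $ i + - z $ i)))"
      by (intro elementary.intros)
    with insert.hyps show ?case by simp
  qed
  have "(norm (y - z))\<^sup>2 = (\<Sum>i\<in>UNIV. (y $ i + - z $ i) * (y $ i + - z $ i))" for y
    by (simp add: power2_norm_eq_inner inner_vec_def)
  then show ?thesis
    using sum[of UNIV] by simp
qed

text \<open>The quotient A / (A + B) works, where \<open>A\<close> is positive exactly inside radius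
  2r and \<open>B\<close> exactly outside radius r. These regions cover the space, so the
  denominator never vanishes and division is a power with exponent -1.\<close>

lemma exists_smooth_cutoff:
  fixes z :: "real ^ 'n::finite"
  assumes "r > 0"
  shows "\<exists>\<eta>. elementary \<eta> \<and> (\<forall>y\<in>ball z r. \<eta> y = 1) \<and> {y. \<eta> y \<noteq> 0} \<subseteq> cball z (2 * r)"
proof -
  define q where "q y = (norm (y - z))\<^sup>2" for y
  define A where "A y = flat 0 ((2 * r)\<^sup>2 + (- 1) * q y)" for y
  define B where "B y = flat 0 (q y + (- r\<^sup>2))" for y
  define \<eta> where "\<eta> y = A y * (A y + B y) powr (- 1)" for y
  have q: "elementary q"
    unfolding q_def by (rule elementary_norm_diff)
  have AB: "elementary A" "elementary B"
    unfolding A_def B_def by (intro elementary.intros q)+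
  have "r\<^sup>2 < (2 * r)\<^sup>2"
    using assms by (simp add: power2_eq_square)
  then have "(2 * r)\<^sup>2 + (- 1) * q y > 0 \<or> q y + (- r\<^sup>2) > 0" for y
    by linarith
  then have "A y > 0 \<or> B y > 0" for y
    unfolding A_def B_def using flat_pos by blast
  moreover have "A y \<ge> 0" "B y \<ge> 0" for y
    by (simp_all add: A_def B_def flat_nonneg)
  ultimately have pos: "A y + B y > 0" for y
    by (meson add_nonneg_pos add_pos_nonneg)
  have "elementary \<eta>"
    unfolding \<eta>_def by (intro elementary.intros AB pos)
  moreover have "\<eta> y = 1" if "y \<in> ball z r" for y
  proof -
    have "norm (y - z) < r"
      using that by (simp add: dist_norm norm_minus_commute)
    then have "q y \<le> r\<^sup>2"
      unfolding q_def by (intro power_mono) auto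
    then have "B y = 0"
      by (simp add: B_def flat_eq_0)
    then show ?thesis
      using pos[of y] by (simp add: \<eta>_def powr_minus)
  qed
  moreover have "y \<in> cball z (2 * r)" if "\<eta> y \<noteq> 0" for y
  proof (rule ccontr)
    assume "y \<notin> cball z (2 * r)"
    then have "2 * r \<le> norm (y - z)"
      by (simp add: dist_norm norm_minus_commute)
    then have "(2 * r)\<^sup>2 \<le> q y"
      unfolding q_def using assms by (intro power_mono) auto
    then show False
      using that by (simp add: \<eta>_def A_def flat_eq_0)
  qed
  ultimately show ?thesis by blast
qed

text \<open>A cutoff factor supplies the compact support that the regularised kernel lacks. Changing
  the kernel off the ball is harmless for functions that vanish there almost everywhere.\<close>

lemma exists_test_function_eq_on_ball:
  fixes z :: "real ^ 'n::finite"
  assumes "elementary f" "r > 0"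
  shows "\<exists>\<phi>\<in>test_functions. \<forall>y\<in>ball z r. \<phi> y = of_real (f y)"
proof -
  obtain \<eta> where \<eta>: "elementary \<eta>" "\<And>y. y \<in> ball z r \<Longrightarrow> \<eta> y = 1" "{y. \<eta> y \<noteq> 0} \<subseteq> cball z (2 * r)"
    using exists_smooth_cutoff[OF assms(2)] by blast
  let ?\<phi> = "\<lambda>y. complex_of_real (\<eta> y * f y)"
  have "smooth ?\<phi>"
    by (intro elementary_smooth elementary.mult \<eta> assms)
  moreover have "bounded {y. ?\<phi> y \<noteq> 0}"
    by (rule bounded_subset[OF bounded_cball]) (use \<eta>(3) in auto)
  ultimately have "?\<phi> \<in> test_functions"
    by (simp add: test_functions_def)
  then show ?thesis
    using \<eta>(2) by (intro bexI[of _ ?\<phi>]) auto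
qed

section \<open>The regularised Newton kernel\<close>

definition newton_reg :: "real \<Rightarrow> real ^ 'n::finite \<Rightarrow> real" where
  "newton_reg e z = ((norm z)\<^sup>2 + e\<^sup>2) powr (1 - real CARD('n) / 2)"

text \<open>
  Up to the factor \<open>n(2 - n)\<close> the Laplacian of the regularised Newton kernel. The total mass is not
  normalised: it is independent of \<open>e\<close>, and only its positivity matters.
\<close>

definition bump_kernel :: "real \<Rightarrow> real ^ 'n::finite \<Rightarrow> real" where
  "bump_kernel e z = e\<^sup>2 * ((norm z)\<^sup>2 + e\<^sup>2) powr (- 1 - real CARD('n) / 2)"

lemma borel_measurable_newton_reg [measurable]:
  "newton_reg e \<in> borel_measurable borel" "bump_kernel e \<in> borel_measurable borel"
  unfolding newton_reg_def bump_kernel_def by measurable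

lemma has_real_derivative_norm_sq_axis:
  fixes z :: "real ^ 'n::finite"
  shows "((\<lambda>t. (norm (y + t *\<^sub>R axis i 1 - z))\<^sup>2) has_real_derivative 2 * (y $ i - z $ i)) (at 0)"
proof -
  have "(norm (y + t *\<^sub>R axis i 1 - z))\<^sup>2 = (norm (y - z))\<^sup>2 + 2 * t * (y $ i - z $ i) + t\<^sup>2" for t
    unfolding power2_norm_eq_inner
    by (simp add: inner_simps inner_axis inner_axis' power2_eq_square inner_commute algebra_simps)
  then show ?thesis
    by (auto intro!: derivative_eq_intros)
qed

lemma partial_deriv_norm_sq_powr:
  fixes z :: "real ^ 'n::finite"
  assumes "c > 0"
  defines "q \<equiv> \<lambda>y. (norm (y - z))\<^sup>2 + c"
  shows "partial_deriv i (\<lambda>y. complex_of_real (q y powr a)) y =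
      of_real (2 * a * (y $ i - z $ i) * q y powr (a - 1))"
    and "partial_derivs [i, i] (\<lambda>y. complex_of_real (q y powr a)) y =
      of_real (2 * a * q y powr (a - 1) + 4 * a * (a - 1) * (y $ i - z $ i)\<^sup>2 * q y powr (a - 2))"
proof -
  have q: "q y > 0" for y
    unfolding q_def using assms(1) by (simp add: add_nonneg_pos)
  have dq: "((\<lambda>t. q (y + t *\<^sub>R axis i 1)) has_real_derivative 2 * (y $ i - z $ i)) (at 0)" for y
    unfolding q_def using DERIV_add[OF has_real_derivative_norm_sq_axis DERIV_const] by simp
  have dpow: "((\<lambda>t. q (y + t *\<^sub>R axis i 1) powr b) has_real_derivative
      2 * b * (y $ i - z $ i) * q y powr (b - 1)) (at 0)" for y b
    using DERIV_chain2[OF has_real_derivative_powr dq[of y], of b] q[of y] by (simp add: mult_ac)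
  \<comment> \<open>Stated for every \<open>y\<close>, since the second derivative differentiates
    the first one as a function.\<close>
  show d1: "partial_deriv i (\<lambda>y. complex_of_real (q y powr a)) y =
      of_real (2 * a * (y $ i - z $ i) * q y powr (a - 1))" for y
    by (rule partial_deriv_of_real(2)[OF dpow])
  have lin: "((\<lambda>t. 2 * a * ((y + t *\<^sub>R axis i 1) $ i - z $ i)) has_real_derivative 2 * a) (at 0)"
    by (auto intro!: derivative_eq_intros)
  have "((\<lambda>t. 2 * a * ((y + t *\<^sub>R axis i 1) $ i - z $ i) * q (y + t *\<^sub>R axis i 1) powr (a - 1))
      has_real_derivative
      (2 * a * q y powr (a - 1) + 4 * a * (a - 1) * (y $ i - z $ i)\<^sup>2 * q y powr (a - 2))) (at 0)"
    using DERIV_mult[OF lin dpow[of y "a - 1"]]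
    by (simp add: power2_eq_square algebra_simps)
  then have "partial_deriv i (\<lambda>y. complex_of_real (2 * a * (y $ i - z $ i) * q y powr (a - 1))) y =
      of_real (2 * a * q y powr (a - 1) + 4 * a * (a - 1) * (y $ i - z $ i)\<^sup>2 * q y powr (a - 2))"
    by (rule partial_deriv_of_real(2))
  moreover have "partial_deriv i (\<lambda>y. complex_of_real (q y powr a)) =
      (\<lambda>y. of_real (2 * a * (y $ i - z $ i) * q y powr (a - 1)))"
    by (rule ext) (rule d1)
  ultimately show "partial_derivs [i, i] (\<lambda>y. complex_of_real (q y powr a)) y =
      of_real (2 * a * q y powr (a - 1) + 4 * a * (a - 1) * (y $ i - z $ i)\<^sup>2 * q y powr (a - 2))"
    by simp
qed

text \<open>For a = 1 - n/2 one has 4a(a - 1) = -2na, so the two terms of the summed second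
  derivatives combine to 2na (q - |y - x|^2) q^(a - 2). Here q - |y - x|^2 = e^2 and 2a = 2 -
  n.\<close>

lemma laplacian_newton_reg:
  fixes x y :: "real ^ 'n::finite"
  assumes "e > 0"
  shows "(\<Sum>i\<in>UNIV. partial_derivs [i, i] (\<lambda>y. complex_of_real (newton_reg e (y - x))) y) =
      of_real (real CARD('n) * (2 - real CARD('n)) * bump_kernel e (y - x))"
proof -
  let ?n = "real CARD('n)"
  define a where "a = 1 - ?n / 2"
  define q where "q = (norm (y - x))\<^sup>2 + e\<^sup>2"
  have "e\<^sup>2 > 0"
    using assms by simp
  then have "q > 0"
    unfolding q_def by (simp add: add_nonneg_pos)
  have norm_sq: "(norm (y - x))\<^sup>2 = (\<Sum>i\<in>UNIV. (y $ i - x $ i)\<^sup>2)"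
    by (simp only: power2_norm_eq_inner inner_vec_def) (simp add: power2_eq_square)
  have "(\<Sum>i\<in>UNIV. partial_derivs [i, i] (\<lambda>y. complex_of_real (newton_reg e (y - x))) y) =
      (\<Sum>i\<in>UNIV. of_real (2 * a * q powr (a - 1) + 4 * a * (a - 1) * (y $ i - x $ i)\<^sup>2 * q powr (a - 2)))"
    unfolding newton_reg_def a_def[symmetric] q_def
    by (intro sum.cong refl partial_deriv_norm_sq_powr(2) \<open>e\<^sup>2 > 0\<close>)
  also have "\<dots> = of_real (?n * (2 * a * q powr (a - 1)) +
      4 * a * (a - 1) * (norm (y - x))\<^sup>2 * q powr (a - 2))"
    unfolding norm_sq by (simp add: sum.distrib sum_distrib_left sum_distrib_right)
  also have "q powr (a - 1) = q * q powr (a - 2)"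
    using \<open>q > 0\<close> powr_add[of q 1 "a - 2"] by simp
  also have "?n * (2 * a * (q * q powr (a - 2))) + 4 * a * (a - 1) * (norm (y - x))\<^sup>2 * q powr (a - 2) =
      ?n * (2 - ?n) * (e\<^sup>2 * q powr (a - 2))"
    by (simp add: a_def q_def field_simps)
  also have "q powr (a - 2) = q powr (- 1 - ?n / 2)"
    by (simp add: a_def)
  finally show ?thesis
    by (simp add: bump_kernel_def q_def)
qed

lemma elementary_newton_reg:
  fixes x :: "real ^ 'n::finite"
  assumes "e > 0"
  shows "elementary (\<lambda>y. newton_reg e (y - x))"
  unfolding newton_reg_def
  using assms by (intro elementary.intros elementary_norm_diff) (simp add: add_nonneg_pos)

section \<open>The weak equation tested with the regularised kernel\<close>

lemma partial_derivs_eq_0_outside: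
  assumes "y \<notin> closure {x. \<phi> x \<noteq> 0}"
  shows "partial_derivs is \<phi> y = 0"
proof -
  have "partial_derivs is \<phi> y = partial_derivs is (\<lambda>_. 0) y"
    by (rule partial_derivs_eq_on_open[of "- closure {x. \<phi> x \<noteq> 0}"])
      (use assms closure_subset[of "{x. \<phi> x \<noteq> 0}"] in auto)
  moreover have "partial_derivs is (\<lambda>_. 0) = (\<lambda>_. 0)" for "is" :: "'a list"
    by (induction "is") (auto simp: partial_deriv_def)
  ultimately show ?thesis by simp
qed

lemma integrable_locally_integrable_mult:
  fixes g \<psi> :: "real ^ 'n::finite \<Rightarrow> complex"
  assumes "locally_integrable g" "continuous_on UNIV \<psi>" "compact K"
    and "\<And>x. x \<notin> K \<Longrightarrow> \<psi> x = 0"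
  shows "integrable lebesgue (\<lambda>x. g x * \<psi> x)"
proof -
  have int: "integrable lebesgue (\<lambda>x. indicator K x *\<^sub>R g x)"
    using assms unfolding locally_integrable_def set_integrable_def by auto
  have meas: "\<psi> \<in> borel_measurable lebesgue"
    using borel_measurable_continuous_onI[OF assms(2)] by (simp add: measurable_completion)
  obtain B where B: "\<And>x. x \<in> K \<Longrightarrow> norm (\<psi> x) \<le> B"
    using compact_continuous_image[OF continuous_on_subset[OF assms(2)] assms(3)]
    by (meson bounded_iff compact_imp_bounded imageI subset_UNIV)
  have bound: "norm (\<psi> x) \<le> max B 0" for x
    using B[of x] assms(4)[of x] by (cases "x \<in> K") auto
  have "integrable lebesgue (\<lambda>x. (indicator K x *\<^sub>R g x) * \<psi> x)"
  proof (rule Bochner_Integration.integrable_bound)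
    show "integrable lebesgue (\<lambda>x. max B 0 *\<^sub>R (indicator K x *\<^sub>R g x))"
      by (intro integrable_scaleR_right int)
    show "(\<lambda>x. (indicator K x *\<^sub>R g x) * \<psi> x) \<in> borel_measurable lebesgue"
      by (intro borel_measurable_times borel_measurable_integrable[OF int] meas)
    show "AE x in lebesgue. norm ((indicator K x *\<^sub>R g x) * \<psi> x)
        \<le> norm (max B 0 *\<^sub>R (indicator K x *\<^sub>R g x))"
    proof (rule AE_I2)
      fix x
      show "norm ((indicator K x *\<^sub>R g x) * \<psi> x) \<le> norm (max B 0 *\<^sub>R (indicator K x *\<^sub>R g x))"
        using mult_right_mono[OF bound[of x], of "norm (indicator K x *\<^sub>R g x)"]
        by (simp only: norm_mult norm_scaleR) (simp add: mult_ac)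
    qed
  qed
  moreover have "(indicator K x *\<^sub>R g x) * \<psi> x = g x * \<psi> x" for x
    using assms(4)[of x] by (cases "x \<in> K") auto
  ultimately show ?thesis by simp
qed

lemma continuous_imp_lebesgue_measurable:
  fixes f :: "'a::euclidean_space \<Rightarrow> 'b::topological_space"
  shows "continuous_on UNIV f \<Longrightarrow> f \<in> borel_measurable lebesgue"
  by (simp add: borel_measurable_continuous_onI measurable_completion)

text \<open>The truncations to balls of radius k are integrable, hence measurable, and they converge
  pointwise to \<open>g\<close>.\<close>

lemma locally_integrable_measurable:
  fixes g :: "real ^ 'n::finite \<Rightarrow> complex"
  assumes "locally_integrable g"
  shows "g \<in> borel_measurable lebesgue"
proof (rule borel_measurable_LIMSEQ_metric)
  fix k :: nat
  have "set_integrable lebesgue (cball 0 (real k)) g"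
    using assms unfolding locally_integrable_def by auto
  then show "(\<lambda>x. indicator (cball 0 (real k)) x *\<^sub>R g x) \<in> borel_measurable lebesgue"
    unfolding set_integrable_def by (rule borel_measurable_integrable)
next
  fix x :: "real ^ 'n"
  obtain k0 where "norm x \<le> real k0"
    using real_arch_simple by blast
  then have "eventually (\<lambda>k. indicator (cball 0 (real k)) x *\<^sub>R g x = g x) sequentially"
    by (intro eventually_sequentiallyI[of k0]) auto
  then show "(\<lambda>k. indicator (cball 0 (real k)) x *\<^sub>R g x) \<longlonglongrightarrow> g x"
    by (rule tendsto_eventually)
qed

text \<open>The weak equations for all directions are added; two derivatives give the sign (-1)^2 =
  1. The compact support of \<open>\<phi>\<close> supplies the integrability needed to move the sums
  through the integrals.\<close>

lemma weak_laplacian_test: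
  fixes u :: "real ^ 'n::finite \<Rightarrow> complex"
  assumes weak: "\<And>i. has_weak_deriv u [i, i] (w i)" and \<phi>: "\<phi> \<in> test_functions"
  shows "(LINT x|lebesgue. u x * (\<Sum>i\<in>UNIV. partial_derivs [i, i] \<phi> x)) =
      (LINT x|lebesgue. (\<Sum>i\<in>UNIV. w i x) * \<phi> x)"
proof -
  let ?K = "closure {x. \<phi> x \<noteq> 0}"
  have K: "compact ?K" and cont: "continuous_on UNIV (partial_derivs is \<phi>)" for "is"
    using \<phi> by (auto simp: test_functions_def smooth_def)
  have int1: "integrable lebesgue (\<lambda>x. u x * partial_derivs [i, i] \<phi> x)" for i
    using weak[of i] K cont
    by (intro integrable_locally_integrable_mult[of _ _ ?K])
      (auto simp: has_weak_deriv_def simp del: partial_derivs.simps intro: partial_derivs_eq_0_outside)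
  have int2: "integrable lebesgue (\<lambda>x. w i x * \<phi> x)" for i
    using weak[of i] K cont[of "[]"] closure_subset[of "{x. \<phi> x \<noteq> 0}"]
    by (intro integrable_locally_integrable_mult[of _ _ ?K]) (auto simp: has_weak_deriv_def)
  have "(LINT x|lebesgue. u x * partial_derivs [i, i] \<phi> x) = (LINT x|lebesgue. w i x * \<phi> x)" for i
    using weak[of i] \<phi> by (simp add: has_weak_deriv_def)
  then show ?thesis
    unfolding sum_distrib_left sum_distrib_right
    by (subst (1 2) Bochner_Integration.integral_sum) (auto simp: int1 int2 simp del: partial_derivs.simps)
qed

text \<open>On the open ball the test function has the values and the Laplacian of the kernel; off
  the ball the other factor vanishes almost everywhere. So the cutoff disappears from both
  integrals, wherever the pole \<open>x\<close> lies.\<close>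

lemma weak_laplacian_newton_reg:
  fixes u :: "real ^ 'n::finite \<Rightarrow> complex"
  assumes weak: "\<And>i. has_weak_deriv u [i, i] (w i)" and "r > 0" "e > 0"
    and u0: "AE y in lebesgue. y \<notin> ball z r \<longrightarrow> u y = 0"
    and w0: "AE y in lebesgue. y \<notin> ball z r \<longrightarrow> (\<Sum>i\<in>UNIV. w i y) = 0"
  shows "of_real (real CARD('n) * (2 - real CARD('n))) * (LINT y|lebesgue. u y * of_real (bump_kernel e (y - x))) =
      (LINT y|lebesgue. (\<Sum>i\<in>UNIV. w i y) * of_real (newton_reg e (y - x)))"
proof -
  obtain \<phi> where \<phi>: "\<phi> \<in> test_functions"
    "\<And>y. y \<in> ball z r \<Longrightarrow> \<phi> y = of_real (newton_reg e (y - x))"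
    using exists_test_function_eq_on_ball[OF elementary_newton_reg[OF \<open>e > 0\<close>] \<open>r > 0\<close>] by blast
  have lap: "(\<Sum>i\<in>UNIV. partial_derivs [i, i] \<phi> y) =
      of_real (real CARD('n) * (2 - real CARD('n)) * bump_kernel e (y - x))" if "y \<in> ball z r" for y
    unfolding laplacian_newton_reg[OF \<open>e > 0\<close>, symmetric]
    by (intro sum.cong refl partial_derivs_eq_on_open[OF open_ball that] \<phi>)
  have u: "u \<in> borel_measurable lebesgue" and w: "\<And>i. w i \<in> borel_measurable lebesgue"
    using weak locally_integrable_measurable by (auto simp: has_weak_deriv_def)
  have "continuous_on UNIV (partial_derivs is \<phi>)" for "is"
    using \<phi>(1) by (simp add: test_functions_def smooth_def)
  from this[THEN continuous_imp_lebesgue_measurable] this[of "[]", THEN continuous_imp_lebesgue_measurable]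
  have d: "partial_derivs [i, i] \<phi> \<in> borel_measurable lebesgue" "\<phi> \<in> borel_measurable lebesgue" for i
    by (simp_all del: partial_derivs.simps(2))
  note [measurable] = u w d
  have [measurable]: "(\<lambda>y. newton_reg e (y - x)) \<in> borel_measurable lebesgue"
    "(\<lambda>y. bump_kernel e (y - x)) \<in> borel_measurable lebesgue"
    by (intro measurable_completion; measurable)+
  have "of_real (real CARD('n) * (2 - real CARD('n))) * (LINT y|lebesgue. u y * of_real (bump_kernel e (y - x))) =
     (LINT y|lebesgue. u y * of_real (real CARD('n) * (2 - real CARD('n)) * bump_kernel e (y - x)))"
    by (subst integral_mult_right_zero[symmetric]) (simp add: mult_ac)
  also have "\<dots> = (LINT y|lebesgue. u y * (\<Sum>i\<in>UNIV. partial_derivs [i, i] \<phi> y))"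
    using u0 lap by (intro integral_cong_AE) (auto simp del: partial_derivs.simps)
  also have "\<dots> = (LINT y|lebesgue. (\<Sum>i\<in>UNIV. w i y) * \<phi> y)"
    by (rule weak_laplacian_test[OF weak \<phi>(1)])
  also have "\<dots> = (LINT y|lebesgue. (\<Sum>i\<in>UNIV. w i y) * of_real (newton_reg e (y - x)))"
    using w0 \<phi>(2) by (intro integral_cong_AE) auto
  finally show ?thesis .
qed

section \<open>Kernel estimates\<close>

text \<open>For \<open>n \<ge> 3\<close> the value at the origin is the junk value 0, hence the exclusion of \<open>z = 0\<close> below.\<close>

definition riesz_kernel :: "real ^ 'n::finite \<Rightarrow> real" where
  "riesz_kernel z = 1 / norm z ^ (CARD('n) - 2)"

lemma borel_measurable_riesz_kernel [measurable]: "riesz_kernel \<in> borel_measurable borel"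
  unfolding riesz_kernel_def by measurable

lemma kernels_nonneg: "newton_reg e z \<ge> 0" "bump_kernel e z \<ge> 0" "riesz_kernel z \<ge> 0"
  by (simp_all add: newton_reg_def bump_kernel_def riesz_kernel_def)

lemma powr_minus_nat: "0 < x \<Longrightarrow> x powr (- real k) = 1 / x ^ k" for x :: real
  by (simp add: powr_minus powr_realpow divide_inverse)

lemma newton_reg_0:
  fixes z :: "real ^ 'n::finite"
  assumes "CARD('n) \<ge> 2" "z \<noteq> 0"
  shows "newton_reg 0 z = riesz_kernel z"
proof -
  have "newton_reg 0 z = norm z powr (2 * (1 - real CARD('n) / 2))"
    using assms by (simp add: newton_reg_def powr_powr flip: powr_numeral)
  also have "2 * (1 - real CARD('n) / 2) = - real (CARD('n) - 2)"
    using assms by (simp add: of_nat_diff)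
  also have "norm z powr (- real (CARD('n) - 2)) = riesz_kernel z"
    unfolding riesz_kernel_def using assms(2) by (intro powr_minus_nat) simp
  finally show ?thesis .
qed

text \<open>The exponent 1 - n/2 is nonpositive, so adding e^2 to the base only lowers the value.
  This gives a majorant independent of \<open>e\<close> for the limit e -> 0.\<close>

lemma newton_reg_le_riesz_kernel:
  fixes z :: "real ^ 'n::finite"
  assumes "CARD('n) \<ge> 2" "z \<noteq> 0"
  shows "newton_reg e z \<le> riesz_kernel z"
proof -
  have "newton_reg e z \<le> newton_reg 0 z"
    unfolding newton_reg_def using assms by (intro powr_mono2') auto
  then show ?thesis
    using newton_reg_0[OF assms] by simp
qed

lemma tendsto_newton_reg:
  fixes z :: "real ^ 'n::finite"
  assumes "CARD('n) \<ge> 2" "z \<noteq> 0" "(e \<longlongrightarrow> 0) F"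
  shows "((\<lambda>k. newton_reg (e k) z) \<longlongrightarrow> riesz_kernel z) F"
proof -
  have "((\<lambda>k. newton_reg (e k) z) \<longlongrightarrow> newton_reg 0 z) F"
    unfolding newton_reg_def using assms by (intro tendsto_intros) auto
  then show ?thesis
    using newton_reg_0[OF assms(1,2)] by simp
qed

text \<open>The prefactor scales by e^2 and the power by e^(-2-n), leaving e^(-n). The kernels are
  therefore rescalings of one profile with common mass, an approximate identity up to
  normalisation.\<close>

lemma bump_kernel_scale:
  fixes z :: "real ^ 'n::finite"
  assumes "e > 0"
  shows "e ^ CARD('n) * bump_kernel e (e *\<^sub>R z) = bump_kernel 1 z"
proof -
  let ?n = "real CARD('n)"
  have "(norm (e *\<^sub>R z))\<^sup>2 + e\<^sup>2 = e\<^sup>2 * ((norm z)\<^sup>2 + 1)"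
    by (simp add: power_mult_distrib algebra_simps)
  then have "bump_kernel e (e *\<^sub>R z) =
      e\<^sup>2 * ((e\<^sup>2) powr (- 1 - ?n / 2) * ((norm z)\<^sup>2 + 1) powr (- 1 - ?n / 2))"
    unfolding bump_kernel_def using assms by (simp add: powr_mult)
  also have "(e\<^sup>2) powr (- 1 - ?n / 2) = e powr (2 * (- 1 - ?n / 2))"
    using assms by (simp add: powr_powr flip: powr_numeral)
  also have "2 * (- 1 - ?n / 2) = - real (CARD('n) + 2)"
    by simp
  also have "e powr (- real (CARD('n) + 2)) = 1 / e ^ (CARD('n) + 2)"
    by (rule powr_minus_nat[OF assms])
  finally show ?thesis
    using assms by (simp add: bump_kernel_def power_add power2_eq_square)
qed

lemma bump_kernel_le:
  fixes z :: "real ^ 'n::finite"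
  assumes "e > 0"
  shows "bump_kernel e z \<le> bump_kernel e (0 :: real ^ 'n)"
  unfolding bump_kernel_def using assms by (intro mult_left_mono powr_mono2') auto

section \<open>Finiteness of kernel integrals by dyadic layers\<close>

lemma le_suminf: "f k \<le> suminf f" for f :: "nat \<Rightarrow> ennreal"
  using sum_le_suminf[of f "{k}"] by simp

text \<open>Off the origin, a null set, \<open>f\<close> is at most the sum of the
  \<open>c k\<close> times the indicators of the balls of radius \<open>\<rho> k\<close>, so only
  volumes of balls enter. Exempting the zeros of \<open>f\<close> admits kernels that are cut
  off.\<close>

lemma nn_integral_finite_of_balls:
  fixes f :: "real ^ 'n::finite \<Rightarrow> real"
  assumes [measurable]: "f \<in> borel_measurable borel"
    and bound: "\<And>z. z \<noteq> 0 \<Longrightarrow> f z \<noteq> 0 \<Longrightarrow> \<exists>k. norm z < \<rho> k \<and> f z \<le> c k"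
    and nonneg: "\<And>k. \<rho> k \<ge> 0" "\<And>k::nat. c k \<ge> 0"
    and "summable (\<lambda>k. c k * \<rho> k ^ CARD('n))"
  shows "(\<integral>\<^sup>+z. ennreal (f z) \<partial>lborel) < \<infinity>"
proof -
  have le: "ennreal (f z) \<le> (\<Sum>k. ennreal (c k) * indicator (ball 0 (\<rho> k)) z)" if z: "z \<noteq> 0" for z
  proof (cases "f z = 0")
    case False
    then obtain k where k: "norm z < \<rho> k" "f z \<le> c k"
      using bound[OF z] by auto
    then have "ennreal (f z) \<le> ennreal (c k) * indicator (ball 0 (\<rho> k)) z"
      by (simp add: ennreal_leI)
    also have "\<dots> \<le> (\<Sum>k. ennreal (c k) * indicator (ball 0 (\<rho> k)) z)"
      by (rule le_suminf)
    finally show ?thesis .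
  qed simp
  have "AE z in lborel. ennreal (f z) \<le> (\<Sum>k. ennreal (c k) * indicator (ball 0 (\<rho> k)) z)"
    using AE_lborel_singleton[of 0] by eventually_elim (rule le)
  then have "(\<integral>\<^sup>+z. ennreal (f z) \<partial>lborel) \<le>
      (\<integral>\<^sup>+z. (\<Sum>k. ennreal (c k) * indicator (ball 0 (\<rho> k)) (z :: real ^ 'n)) \<partial>lborel)"
    by (rule nn_integral_mono_AE)
  also have "\<dots> = (\<Sum>k. \<integral>\<^sup>+z. ennreal (c k) * indicator (ball 0 (\<rho> k)) z \<partial>(lborel :: (real ^ 'n) measure))"
    by (rule nn_integral_suminf) (intro borel_measurable_times_ennreal borel_measurable_const borel_measurable_indicator, simp)
  also have "\<dots> = (\<Sum>k. ennreal (unit_ball_vol CARD('n) * (c k * \<rho> k ^ CARD('n))))"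
    using nonneg by (simp add: nn_integral_cmult_indicator emeasure_ball ennreal_mult'[symmetric] mult_ac)
  also have "\<dots> < \<infinity>"
    using assms by (simp only: infinity_ennreal_def less_top[symmetric])
      (intro ennreal_suminf_neq_top summable_mult, auto simp: nonneg)
  finally show ?thesis .
qed

text \<open>For 2^(k-1) <= |z| < 2^k the kernel is at most (2/2^k)^(n+2), while the ball of radius
  2^k has volume of order 2^(kn). The products decay like 4^(-k).\<close>

lemma nn_integral_bump_kernel_finite:
  "(\<integral>\<^sup>+z. ennreal (bump_kernel 1 (z :: real ^ 'n::finite)) \<partial>lborel) < \<infinity>"
proof (rule nn_integral_finite_of_balls[where \<rho> = "\<lambda>k. 2 ^ k" and c = "\<lambda>k. (2 / 2 ^ k) ^ (CARD('n) + 2)"])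
  fix z :: "real ^ 'n" assume "z \<noteq> 0"
  obtain k0 where "norm z < 2 ^ k0"
    using real_arch_pow[of 2 "norm z"] by auto
  \<comment> \<open>Minimality of \<open>k\<close> bounds |z| below by 2^(k-1); for k = 0 the
    summand 1 in \<open>?N\<close> takes over.\<close>
  define k where "k = (LEAST k. norm z < 2 ^ k)"
  have k: "norm z < 2 ^ k"
    unfolding k_def by (rule LeastI) fact
  let ?N = "(norm z)\<^sup>2 + 1" and ?s = "2 ^ k / 2 :: real"
  have "?s ^ 2 \<le> ?N"
  proof (cases k)
    case 0
    then show ?thesis by (simp add: power2_eq_square)
  next
    case (Suc m)
    then have "2 ^ m \<le> norm z"
      using not_less_Least[of m "\<lambda>k. norm z < 2 ^ k"] by (simp add: k_def)
    then have "(2 ^ m)\<^sup>2 \<le> (norm z)\<^sup>2"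
      by (intro power_mono) auto
    then have "(2 ^ m)\<^sup>2 \<le> ?N"
      by linarith
    then show ?thesis
      using Suc by simp
  qed
  then have "bump_kernel 1 z \<le> (?s ^ 2) powr (- 1 - real CARD('n) / 2)"
    unfolding bump_kernel_def by (simp del: power_divide) (intro powr_mono2'; simp)
  also have "\<dots> = ?s powr (2 * (- 1 - real CARD('n) / 2))"
    by (simp only: powr_powr[symmetric]) (simp add: powr_numeral)
  also have "2 * (- 1 - real CARD('n) / 2) = - real (CARD('n) + 2)"
    by simp
  also have "?s powr (- real (CARD('n) + 2)) = (2 / 2 ^ k) ^ (CARD('n) + 2)"
    by (subst powr_minus_nat) (simp_all add: power_divide)
  finally show "\<exists>k. norm z < 2 ^ k \<and> bump_kernel 1 z \<le> (2 / 2 ^ k) ^ (CARD('n) + 2)"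
    using k by blast
next
  have "(2 / 2 ^ k) ^ (CARD('n) + 2) * (2 ^ k) ^ CARD('n) = (2 :: real) ^ (CARD('n) + 2) * (1 / 4) ^ k" for k :: nat
  proof -
    have "(2 / 2 ^ k) ^ (CARD('n) + 2) * (2 ^ k) ^ CARD('n) = (2 :: real) ^ (CARD('n) + 2) * (1 / (2 ^ k) ^ 2)"
      by (simp add: power_divide power_add power2_eq_square)
    also have "((2 :: real) ^ k) ^ 2 = 4 ^ k"
      by (simp add: power2_eq_square flip: power_mult_distrib)
    finally show ?thesis
      by (simp add: power_one_over)
  qed
  then show "summable (\<lambda>k. (2 / 2 ^ k) ^ (CARD('n) + 2) * (2 ^ k) ^ CARD('n) :: real)"
    by (simp add: summable_mult)
qed auto

text \<open>For 2^(-m-1) <= |z| < 2^(-m) the kernel is at most (2^(m+1))^(n-2), while the ball of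
  radius 2^(-m) has volume of order 2^(-mn). The products again decay like 4^(-m).\<close>

lemma nn_integral_riesz_kernel_unit_ball_finite:
  assumes "CARD('n::finite) \<ge> 2"
  shows "(\<integral>\<^sup>+z. ennreal (indicator (ball 0 1) z * riesz_kernel (z :: real ^ 'n)) \<partial>lborel) < \<infinity>"
proof (rule nn_integral_finite_of_balls[where \<rho> = "\<lambda>k. (1 / 2) ^ k" and c = "\<lambda>k. (2 * 2 ^ k) ^ (CARD('n) - 2)"])
  fix z :: "real ^ 'n" assume "z \<noteq> 0" and "indicator (ball 0 1) z * riesz_kernel z \<noteq> 0"
  then have z: "0 < norm z" "norm z < 1"
    by (auto simp: indicator_def split: if_splits)
  then obtain k0 where "(1 / 2) ^ k0 \<le> norm z"
    using real_arch_pow_inv[of "norm z" "1 / 2"] by (auto intro: less_imp_le)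
  define k where "k = (LEAST k. (1 / 2) ^ k \<le> norm z)"
  have k: "(1 / 2) ^ k \<le> norm z"
    unfolding k_def by (rule LeastI) fact
  \<comment> \<open>Since |z| < 1, the least \<open>k\<close> is not 0. Its predecessor
    \<open>m\<close> satisfies |z| < 2^(-m) and is the layer to choose.\<close>
  with z obtain m where m: "k = Suc m"
    by (cases k) auto
  then have "norm z < (1 / 2) ^ m"
    using not_less_Least[of m "\<lambda>k. (1 / 2) ^ k \<le> norm z"] by (simp add: k_def)
  moreover have "1 / norm z \<le> 2 * 2 ^ m"
    using k m z by (simp add: field_simps)
  then have "(1 / norm z) ^ (CARD('n) - 2) \<le> (2 * 2 ^ m) ^ (CARD('n) - 2)"
    by (intro power_mono) auto
  ultimately show "\<exists>k. norm z < (1 / 2) ^ k \<and>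
      indicator (ball 0 1) z * riesz_kernel z \<le> (2 * 2 ^ k) ^ (CARD('n) - 2)"
    using z by (intro exI[of _ m]) (auto simp: riesz_kernel_def power_one_over)
next
  have "(2 * 2 ^ k) ^ (CARD('n) - 2) * ((1 / 2) ^ k) ^ CARD('n) = (2 :: real) ^ (CARD('n) - 2) * (1 / 4) ^ k" for k :: nat
  proof -
    \<comment> \<open>Writing n as (n - 2) + 2 lets the first power cancel the growth of the kernel
      bound; the square is what remains.\<close>
    have "((1 / 2 :: real) ^ k) ^ CARD('n) = ((1 / 2) ^ k) ^ (CARD('n) - 2) * ((1 / 2) ^ k) ^ 2"
      using assms by (simp only: power_add[symmetric] le_add_diff_inverse2)
    then have "(2 * 2 ^ k) ^ (CARD('n) - 2) * ((1 / 2) ^ k) ^ CARD('n) =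
        (2 * 2 ^ k * (1 / 2 :: real) ^ k) ^ (CARD('n) - 2) * ((1 / 2) ^ k) ^ 2"
      by (simp only: power_mult_distrib mult.assoc)
    also have "2 * 2 ^ k * (1 / 2 :: real) ^ k = 2"
      by (simp add: power_one_over)
    also have "((1 / 2 :: real) ^ k) ^ 2 = (1 / 4) ^ k"
      by (simp add: power2_eq_square flip: power_mult_distrib)
    finally show ?thesis .
  qed
  then show "summable (\<lambda>k. (2 * 2 ^ k) ^ (CARD('n) - 2) * ((1 / 2) ^ k) ^ CARD('n) :: real)"
    by (simp only: summable_mult summable_geometric) simp
  show "(\<lambda>z. indicator (ball 0 1) z * riesz_kernel z) \<in> borel_measurable (borel :: (real ^ 'n) measure)"
    by (intro borel_measurable_times borel_measurable_indicator borel_measurable_riesz_kernel) simp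
qed auto

text \<open>Within distance 1 of \<open>y\<close>, translation reduces to the unit ball about the
  origin; beyond that the kernel is at most 1 and contributes at most the measure of
  \<open>Q\<close>. Uniformity in \<open>y\<close> serves Fubini and dominated convergence.\<close>

lemma nn_integral_riesz_kernel_uniform_bound:
  fixes Q :: "(real ^ 'n::finite) set"
  assumes "CARD('n) \<ge> 2" and [measurable]: "Q \<in> sets borel" and "emeasure lborel Q < \<infinity>"
  obtains C where "C \<ge> 0" "\<And>y. (\<integral>\<^sup>+x. ennreal (indicator Q x * riesz_kernel (y - x)) \<partial>lborel) \<le> ennreal C"
proof -
  define g where "g z = indicator (ball 0 1) z * riesz_kernel z" for z :: "real ^ 'n"
  have [measurable]: "g \<in> borel_measurable borel"
    unfolding g_def by (intro borel_measurable_times borel_measurable_indicator borel_measurable_riesz_kernel) simp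
  let ?J = "\<integral>\<^sup>+z. ennreal (g z) \<partial>lborel"
  have bound: "(\<integral>\<^sup>+x. ennreal (indicator Q x * riesz_kernel (y - x)) \<partial>lborel) \<le> ?J + emeasure lborel Q" for y
  proof -
    have "(\<integral>\<^sup>+x. ennreal (indicator Q x * riesz_kernel (y - x)) \<partial>lborel)
      \<le> (\<integral>\<^sup>+x. ennreal (g (x - y)) + indicator Q x \<partial>lborel)"
    proof (rule nn_integral_mono)
      fix x
      show "ennreal (indicator Q x * riesz_kernel (y - x))
          \<le> ennreal (g (x - y)) + indicator Q x"
      proof (cases "norm (x - y) < 1")
        case True
        then show ?thesis
          by (auto simp: g_def indicator_def riesz_kernel_def norm_minus_commute intro: order_trans)
      next
        case False
        then have "1 \<le> norm (y - x) ^ (CARD('n) - 2)"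
          by (intro one_le_power) (simp add: norm_minus_commute)
        then have "riesz_kernel (y - x) \<le> 1"
          by (simp add: riesz_kernel_def divide_le_eq_1)
        then show ?thesis
          using False by (auto simp: g_def indicator_def ennreal_le_1)
      qed
    qed
    also have "\<dots> = (\<integral>\<^sup>+x. ennreal (g (x - y)) \<partial>lborel) + emeasure lborel Q"
      by (subst nn_integral_add) auto
    also have "(\<integral>\<^sup>+x. ennreal (g (x - y)) \<partial>lborel) =
        (\<integral>\<^sup>+x. ennreal (g x) \<partial>distr lborel borel ((+) (- y)))"
      by (subst nn_integral_distr) auto
    also have "\<dots> = ?J"
      by (simp add: lborel_distr_plus)
    finally show ?thesis .
  qed
  have "?J + emeasure lborel Q < \<infinity>"
    using nn_integral_riesz_kernel_unit_ball_finite[OF assms(1)] assms(3) by (simp add: g_def less_top)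
  then obtain C where "C \<ge> 0" "?J + emeasure lborel Q = ennreal C"
    by (cases "?J + emeasure lborel Q") auto
  with bound that show thesis
    by metis
qed

text \<open>Averaging a potential over \<open>Q\<close> moves the average onto the kernel.
  Integrating in x first, the bound \<open>C\<close> times the integral of |h| gives joint
  integrability.\<close>

lemma kernel_Fubini:
  fixes h :: "'a::euclidean_space \<Rightarrow> complex" and \<kappa> :: "'a \<Rightarrow> real"
  assumes h: "integrable lborel h" and [measurable]: "\<kappa> \<in> borel_measurable borel" "Q \<in> sets borel"
    and nonneg: "\<And>z. \<kappa> z \<ge> 0"
    and bound: "\<And>y. (\<integral>\<^sup>+x. ennreal (indicator Q x * \<kappa> (y - x)) \<partial>lborel) \<le> ennreal C"
  shows "integrable lborel (\<lambda>x. indicator Q x *\<^sub>R (LINT y|lborel. h y * of_real (\<kappa> (y - x))))"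
    and "(LINT x|lborel. indicator Q x *\<^sub>R (LINT y|lborel. h y * of_real (\<kappa> (y - x)))) =
      (LINT y|lborel. h y * of_real (LINT x|lborel. indicator Q x * \<kappa> (y - x)))"
proof -
  have [measurable]: "h \<in> borel_measurable borel"
    using borel_measurable_integrable[OF h] by simp
  let ?F = "\<lambda>x y. indicator Q x *\<^sub>R (h y * of_real (\<kappa> (y - x)))"
  have int: "integrable (lborel \<Otimes>\<^sub>M lborel) (case_prod ?F)"
  proof (rule integrableI_bounded)
    show "case_prod ?F \<in> borel_measurable (lborel \<Otimes>\<^sub>M lborel)"
      by measurable
    have "(\<integral>\<^sup>+p. ennreal (norm (case_prod ?F p)) \<partial>(lborel \<Otimes>\<^sub>M lborel)) =
        (\<integral>\<^sup>+y. \<integral>\<^sup>+x. ennreal (norm (?F x y)) \<partial>lborel \<partial>lborel)"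
      by (subst lborel_pair.nn_integral_snd[symmetric]) auto
    also have "\<dots> = (\<integral>\<^sup>+y. ennreal (norm (h y)) * (\<integral>\<^sup>+x. ennreal (indicator Q x * \<kappa> (y - x)) \<partial>lborel) \<partial>lborel)"
      by (subst nn_integral_cmult[symmetric])
        (auto simp: norm_mult nonneg ennreal_mult'[symmetric] mult_ac)
    also have "\<dots> \<le> (\<integral>\<^sup>+y. ennreal (norm (h y)) * ennreal C \<partial>lborel)"
      by (intro nn_integral_mono mult_left_mono bound) auto
    also have "\<dots> = (\<integral>\<^sup>+y. ennreal (norm (h y)) \<partial>lborel) * ennreal C"
      by (rule nn_integral_multc) auto
    also have "\<dots> < \<infinity>"
      using h by (simp add: integrable_iff_bounded ennreal_mult_less_top)
    finally show "(\<integral>\<^sup>+p. ennreal (norm (case_prod ?F p)) \<partial>(lborel \<Otimes>\<^sub>M lborel)) < \<infinity>" .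
  qed
  show "integrable lborel (\<lambda>x. indicator Q x *\<^sub>R (LINT y|lborel. h y * of_real (\<kappa> (y - x))))"
    using lborel_pair.integrable_fst'[OF int] by simp
  have "(LINT x|lborel. indicator Q x *\<^sub>R (LINT y|lborel. h y * of_real (\<kappa> (y - x)))) =
      (LINT x|lborel. LINT y|lborel. ?F x y)"
    by simp
  also have "\<dots> = (LINT y|lborel. LINT x|lborel. ?F x y)"
    by (rule lborel_pair.Fubini_integral[OF int, symmetric])
  also have "(\<lambda>y. LINT x|lborel. ?F x y) = (\<lambda>y. h y * of_real (LINT x|lborel. indicator Q x * \<kappa> (y - x)))"
  proof (rule ext)
    fix y
    have "(LINT x|lborel. ?F x y) = (LINT x|lborel. h y * of_real (indicator Q x * \<kappa> (y - x)))"
      by (intro Bochner_Integration.integral_cong) (auto simp: scaleR_conv_of_real)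
    then show "(LINT x|lborel. ?F x y) = h y * of_real (LINT x|lborel. indicator Q x * \<kappa> (y - x))"
      by (simp only: integral_mult_right_zero integral_complex_of_real)
  qed
  finally show "(LINT x|lborel. indicator Q x *\<^sub>R (LINT y|lborel. h y * of_real (\<kappa> (y - x)))) =
      (LINT y|lborel. h y * of_real (LINT x|lborel. indicator Q x * \<kappa> (y - x)))" .
qed

text \<open>Boxes are stable under intersection and generate the Borel sets, so Dynkin's argument
  extends the vanishing to all Borel sets. The vanishing total integral handles complements.\<close>

lemma AE_zero_if_box_integrals_zero:
  fixes h :: "'a::euclidean_space \<Rightarrow> complex"
  assumes h: "integrable lborel h" and "(LINT x|lborel. h x) = 0"
    and box: "\<And>a b. (LINT x|lborel. indicator (box a b) x *\<^sub>R h x) = 0"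
  shows "AE x in lborel. h x = 0"
proof (rule sigma_finite_measure.density_zero[OF sigma_finite_lborel h])
  have int: "set_integrable lborel A h" if "A \<in> sets borel" for A
    unfolding set_integrable_def using that h by (intro integrable_mult_indicator) auto
  fix A :: "'a set" assume "A \<in> sets lborel"
  have "Int_stable (range (\<lambda>(a, b). box a b :: 'a set))"
    by (auto simp: Int_stable_def box_Int_box)
  moreover have "range (\<lambda>(a, b). box a b :: 'a set) \<subseteq> Pow UNIV"
    by auto
  moreover have "A \<in> sigma_sets UNIV (range (\<lambda>(a, b). box a b))"
    using \<open>A \<in> sets lborel\<close> by (simp add: borel_eq_box)
  ultimately show "set_lebesgue_integral lborel A h = 0"
  proof (induction rule: sigma_sets_induct_disjoint)
    case (basic A)
    then show ?case
      using box by (auto simp: set_lebesgue_integral_def)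
  next
    case empty
    show ?case by (simp add: set_lebesgue_integral_def)
  next
    case (compl A)
    then have A: "A \<in> sets borel"
      by (simp add: borel_eq_box)
    have "set_lebesgue_integral lborel (UNIV - A) h =
        (LINT x|lborel. h x - indicator A x *\<^sub>R h x)"
      unfolding set_lebesgue_integral_def
      by (intro Bochner_Integration.integral_cong) (auto simp: indicator_def)
    also have "\<dots> = 0"
      using int[OF A] h compl assms(2)
      by (simp add: set_integrable_def set_lebesgue_integral_def)
    finally show ?case .
  next
    case (union F)
    then have F: "F i \<in> sets borel" for i
      by (simp add: borel_eq_box subset_eq)
    then have "set_lebesgue_integral lborel (\<Union>i. F i) h = (\<Sum>i. set_lebesgue_integral lborel (F i) h)"
      using union by (intro lebesgue_integral_countable_add int) (auto simp: disjoint_family_on_def)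
    then show ?case
      using union by simp
  qed
qed

section \<open>The Newtonian potential\<close>

text \<open>Positivity of this mass makes the threshold for the Kato bound positive. Were the
  integral zero, the strictly positive kernel would vanish almost everywhere and the whole space
  would be null.\<close>

lemma integral_bump_kernel_pos:
  "(LINT z|lborel. bump_kernel 1 (z :: real ^ 'n::finite)) > 0"
  and integrable_bump_kernel: "integrable lborel (bump_kernel 1 :: real ^ 'n \<Rightarrow> real)"
proof -
  have pos: "bump_kernel 1 z > 0" for z :: "real ^ 'n"
  proof -
    have "0 < (norm z)\<^sup>2 + 1"
      by (simp add: add_nonneg_pos)
    then show ?thesis
      unfolding bump_kernel_def by simp
  qed
  show int: "integrable lborel (bump_kernel 1 :: real ^ 'n \<Rightarrow> real)"
    using nn_integral_bump_kernel_finite[where 'n = 'n]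
    by (intro integrableI_bounded) (auto simp: kernels_nonneg)
  have "(LINT z|lborel. bump_kernel 1 (z :: real ^ 'n)) \<noteq> 0"
  proof
    assume "(LINT z|lborel. bump_kernel 1 (z :: real ^ 'n)) = 0"
    then have "AE z in lborel. bump_kernel 1 (z :: real ^ 'n) = 0"
      by (subst (asm) integral_nonneg_eq_0_iff_AE[OF int]) (auto simp: kernels_nonneg)
    then have "AE z :: real ^ 'n in lborel. False"
      by eventually_elim (use pos in \<open>auto simp: less_le\<close>)
    then show False
      using AE_iff_measurable[of UNIV "lborel :: (real ^ 'n) measure"] by (simp add: emeasure_lborel_UNIV)
  qed
  moreover have "(LINT z|lborel. bump_kernel 1 (z :: real ^ 'n)) \<ge> 0"
    by (simp add: kernels_nonneg)
  ultimately show "(LINT z|lborel. bump_kernel 1 (z :: real ^ 'n)) > 0"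
    by simp
qed

text \<open>Substitute x = y + e z: the Jacobian e^n is absorbed by
  \<open>bump_kernel_scale\<close>, and the kernel is even. The dependence on \<open>e\<close> moves
  from the kernel to the indicator, so that a fixed majorant is available.\<close>

lemma integral_indicator_bump_kernel:
  fixes y :: "real ^ 'n::finite"
  assumes e: "e > 0" and [measurable]: "Q \<in> sets borel"
  shows "(LINT x|lborel. indicator Q x * bump_kernel e (y - x)) =
    (LINT z|lborel. indicator Q (y + e *\<^sub>R z) * bump_kernel 1 z)"
proof -
  let ?g = "\<lambda>x. indicator Q x * bump_kernel e (y - x)"
  have [measurable]: "?g \<in> borel_measurable borel"
    by measurable
  have "(LINT x|lborel. ?g x) =
      (LINT x|density (distr lborel borel (\<lambda>x. y + e *\<^sub>R x)) (\<lambda>_. \<bar>e\<bar> ^ DIM(real ^ 'n)). ?g x)"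
    using lborel_affine[of e y] e by simp
  also have "\<dots> = (LINT x|distr lborel borel (\<lambda>x. y + e *\<^sub>R x). \<bar>e\<bar> ^ CARD('n) *\<^sub>R ?g x)"
    by (subst integral_density) auto
  also have "\<dots> = (LINT z|lborel. \<bar>e\<bar> ^ CARD('n) *\<^sub>R ?g (y + e *\<^sub>R z))"
    by (subst integral_distr) auto
  also have "\<dots> = (LINT z|lborel. indicator Q (y + e *\<^sub>R z) * bump_kernel 1 z)"
  proof (rule Bochner_Integration.integral_cong[OF refl])
    fix z :: "real ^ 'n"
    have "bump_kernel e (y - (y + e *\<^sub>R z)) = bump_kernel e (e *\<^sub>R z)"
      by (simp add: bump_kernel_def)
    then show "\<bar>e\<bar> ^ CARD('n) *\<^sub>R ?g (y + e *\<^sub>R z) = indicator Q (y + e *\<^sub>R z) * bump_kernel 1 z"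
      using e by (simp add: bump_kernel_scale[OF e, symmetric])
  qed
  finally show ?thesis .
qed

text \<open>For fixed z the points y + e_k z converge to y. Off the frontier of \<open>Q\<close> the
  indicator is eventually constant along them, and \<open>bump_kernel 1\<close> dominates.\<close>

lemma tendsto_integral_indicator_bump_kernel:
  fixes y :: "real ^ 'n::finite"
  assumes e: "\<And>k. e k > 0" "e \<longlonglongrightarrow> 0" and [measurable]: "Q \<in> sets borel" and y: "y \<notin> frontier Q"
  shows "(\<lambda>k. LINT x|lborel. indicator Q x * bump_kernel (e k) (y - x))
    \<longlonglongrightarrow> indicator Q y * (LINT z|lborel. bump_kernel 1 (z :: real ^ 'n))"
proof -
  have "(\<lambda>k. LINT z|lborel. indicator Q (y + e k *\<^sub>R z) * bump_kernel 1 z)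
      \<longlonglongrightarrow> (LINT z|lborel. indicator Q y * bump_kernel 1 (z :: real ^ 'n))"
  proof (rule integral_dominated_convergence)
    show "integrable lborel (bump_kernel 1 :: real ^ 'n \<Rightarrow> real)"
      by (rule integrable_bump_kernel)
    show "AE z in lborel. (\<lambda>k. indicator Q (y + e k *\<^sub>R z) * bump_kernel 1 z)
        \<longlonglongrightarrow> indicator Q y * bump_kernel 1 (z :: real ^ 'n)"
    proof (rule AE_I2)
      fix z :: "real ^ 'n"
      have lim: "(\<lambda>k. y + e k *\<^sub>R z) \<longlonglongrightarrow> y"
        using tendsto_add[OF tendsto_const tendsto_scaleR[OF e(2) tendsto_const], of y z] by simp
      have "\<forall>\<^sub>F k in sequentially. indicator Q (y + e k *\<^sub>R z) = (indicator Q y :: real)"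
      proof (cases "y \<in> Q")
        case True
        then have "y \<in> interior Q"
          using y closure_subset[of Q] by (auto simp: frontier_def)
        then have "\<forall>\<^sub>F k in sequentially. y + e k *\<^sub>R z \<in> interior Q"
          using lim by (intro topological_tendstoD[OF lim]) auto
        then show ?thesis
          by eventually_elim (use True interior_subset[of Q] in \<open>auto simp: indicator_def\<close>)
      next
        case False
        then have "y \<in> - closure Q"
          using y interior_subset[of Q] by (auto simp: frontier_def)
        then have "\<forall>\<^sub>F k in sequentially. y + e k *\<^sub>R z \<in> - closure Q"
          using lim by (intro topological_tendstoD[OF lim]) auto
        then show ?thesis
          by eventually_elim (use False closure_subset[of Q] in \<open>auto simp: indicator_def\<close>)
      qed
      then have "\<forall>\<^sub>F k in sequentially. indicator Q (y + e k *\<^sub>R z) * bump_kernel 1 z =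
          indicator Q y * bump_kernel 1 z"
        by eventually_elim simp
      then show "(\<lambda>k. indicator Q (y + e k *\<^sub>R z) * bump_kernel 1 z) \<longlonglongrightarrow> indicator Q y * bump_kernel 1 z"
        by (rule tendsto_eventually)
    qed
  qed (auto simp: indicator_def kernels_nonneg)
  then show ?thesis
    using e by (simp add: integral_indicator_bump_kernel)
qed

text \<open>The equation is averaged over x in the box at fixed e, and then e -> 0. The averaged
  bump kernels tend to \<open>M\<close> times the indicator off a null set, the averaged Newton
  kernels to the averaged Riesz kernel; Fubini then undoes the averaging on the right.\<close>

lemma newton_representation_box:
  fixes u f :: "real ^ 'n::finite \<Rightarrow> complex" and a b :: "real ^ 'n"
  assumes n: "CARD('n) \<ge> 2" and u: "integrable lborel u" and f: "integrable lborel f"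
    and eq: "\<And>x e. e > 0 \<Longrightarrow> of_real c * (LINT y|lborel. u y * of_real (bump_kernel e (y - x))) =
      - (LINT y|lborel. f y * of_real (newton_reg e (y - x)))"
  defines "w \<equiv> \<lambda>x. LINT y|lborel. f y * of_real (riesz_kernel (y - x))"
    and "M \<equiv> LINT z|lborel. bump_kernel 1 (z :: real ^ 'n)"
  shows "integrable lborel (\<lambda>x. indicator (box a b) x *\<^sub>R w x)"
    and "of_real (c * M) * (LINT x|lborel. indicator (box a b) x *\<^sub>R u x) =
      - (LINT x|lborel. indicator (box a b) x *\<^sub>R w x)"
proof -
  define Q where "Q = box a b"
  have Q [measurable]: "Q \<in> sets borel" and fin: "emeasure lborel Q < \<infinity>"
    unfolding Q_def by (simp_all add: emeasure_lborel_box_eq)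
  have [measurable]: "u \<in> borel_measurable borel" "f \<in> borel_measurable borel"
    using borel_measurable_integrable[OF u] borel_measurable_integrable[OF f] by simp_all
  obtain C where C: "C \<ge> 0"
    "\<And>y. (\<integral>\<^sup>+x. ennreal (indicator Q x * riesz_kernel (y - x)) \<partial>lborel) \<le> ennreal C"
    using nn_integral_riesz_kernel_uniform_bound[OF n Q fin] by blast
  have ae: "AE x in lborel. y - x \<noteq> 0" for y :: "real ^ 'n"
    using AE_lborel_singleton[of y] by eventually_elim auto
  \<comment> \<open>Domination by the Riesz kernel makes one constant \<open>C\<close> serve all
    \<open>e\<close>; it later bounds \<open>s k\<close> uniformly.\<close>
  have Cn: "(\<integral>\<^sup>+x. ennreal (indicator Q x * newton_reg e (y - x)) \<partial>lborel) \<le> ennreal C" for e y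
  proof (rule order_trans[OF nn_integral_mono_AE C(2)[of y]])
    show "AE x in lborel. ennreal (indicator Q x * newton_reg e (y - x))
        \<le> ennreal (indicator Q x * riesz_kernel (y - x))"
      using ae[of y]
      by eventually_elim (intro ennreal_leI mult_left_mono newton_reg_le_riesz_kernel n, auto)
  qed
  \<comment> \<open>This bound blows up as e -> 0 but only justifies Fubini at fixed
    \<open>e\<close>; the uniform bound for \<open>p k\<close> is \<open>M\<close>.\<close>
  have Cb: "(\<integral>\<^sup>+x. ennreal (indicator Q x * bump_kernel e (y - x)) \<partial>lborel)
      \<le> ennreal (bump_kernel e (0 :: real ^ 'n) * measure lborel Q)" if "e > 0" for e y
  proof -
    have "(\<integral>\<^sup>+x. ennreal (indicator Q x * bump_kernel e (y - x)) \<partial>lborel)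
        \<le> (\<integral>\<^sup>+x. ennreal (bump_kernel e (0 :: real ^ 'n)) * indicator Q x \<partial>lborel)"
      by (intro nn_integral_mono) (auto simp: indicator_def intro!: ennreal_leI bump_kernel_le that)
    also have "\<dots> = ennreal (bump_kernel e (0 :: real ^ 'n)) * emeasure lborel Q"
      by (rule nn_integral_cmult_indicator) simp
    also have "emeasure lborel Q = ennreal (measure lborel Q)"
      using fin by (intro emeasure_eq_ennreal_measure) auto
    finally show ?thesis
      by (simp add: ennreal_mult kernels_nonneg)
  qed
  define e where "e k = 1 / real (Suc k)" for k
  have e: "e k > 0" "e \<longlonglongrightarrow> 0" for k
    unfolding e_def using LIMSEQ_inverse_real_of_nat by (simp_all add: inverse_eq_divide)
  define p where "p k y = (LINT x|lborel. indicator Q x * bump_kernel (e k) (y - x))" for k y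
  define s where "s k y = (LINT x|lborel. indicator Q x * newton_reg (e k) (y - x))" for k y
  define R where "R y = (LINT x|lborel. indicator Q x * riesz_kernel (y - x))" for y
  have [measurable]: "p k \<in> borel_measurable borel" "s k \<in> borel_measurable borel" "R \<in> borel_measurable borel" for k
    unfolding p_def s_def R_def by measurable
  have eq': "of_real c * (LINT y|lborel. u y * of_real (p k y)) = - (LINT y|lborel. f y * of_real (s k y))" for k
  proof -
    have "of_real c * (LINT y|lborel. u y * of_real (p k y)) =
        of_real c * (LINT x|lborel. indicator Q x *\<^sub>R (LINT y|lborel. u y * of_real (bump_kernel (e k) (y - x))))"
      unfolding p_def using u e by (subst kernel_Fubini(2)[OF u _ _ _ Cb]) (auto simp: kernels_nonneg)
    also have "\<dots> = (LINT x|lborel. of_real c * indicator Q x *\<^sub>R (LINT y|lborel. u y * of_real (bump_kernel (e k) (y - x))))"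
      by (rule integral_mult_right_zero[symmetric])
    also have "\<dots> = (LINT x|lborel. - (indicator Q x *\<^sub>R (LINT y|lborel. f y * of_real (newton_reg (e k) (y - x)))))"
      by (intro Bochner_Integration.integral_cong refl)
        (simp only: mult_scaleR_right eq[OF e(1)] scaleR_minus_right)
    also have "\<dots> = - (LINT y|lborel. f y * of_real (s k y))"
      unfolding s_def by (subst kernel_Fubini(2)[OF f _ _ _ Cn, symmetric]) (auto simp: kernels_nonneg)
    finally show ?thesis .
  qed
  have lim_u: "(\<lambda>k. LINT y|lborel. u y * of_real (p k y)) \<longlonglongrightarrow> (LINT y|lborel. u y * of_real (indicator Q y * M))"
  proof (rule integral_dominated_convergence)
    show "integrable lborel (\<lambda>y. norm (u y) * M)"
      using u by simp
    \<comment> \<open>A box is convex, so the set where the limit of \<open>p k\<close> is not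
      controlled is null.\<close>
    have "negligible (frontier Q)"
      unfolding Q_def by (intro negligible_convex_frontier convex_box)
    then have "AE y in lborel. y \<notin> frontier Q"
      using AE_not_in[of "frontier Q" lborel]
      by (simp add: negligible_iff_null_sets null_sets_completion_iff frontier_closed borel_closed)
    then show "AE y in lborel. (\<lambda>k. u y * of_real (p k y)) \<longlonglongrightarrow> u y * of_real (indicator Q y * M)"
      unfolding p_def M_def
      by eventually_elim (intro tendsto_intros tendsto_integral_indicator_bump_kernel e Q)
    fix k
    have "\<bar>p k y\<bar> \<le> M" for y
    proof -
      have "p k y \<le> M"
        unfolding p_def M_def integral_indicator_bump_kernel[OF e(1) Q]
        by (intro integral_mono' integrable_bump_kernel) (auto simp: indicator_def kernels_nonneg)
      moreover have "p k y \<ge> 0"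
        unfolding p_def by (simp add: kernels_nonneg)
      ultimately show ?thesis by simp
    qed
    then show "AE y in lborel. norm (u y * of_real (p k y)) \<le> norm (u y) * M"
      by (auto simp: norm_mult intro!: mult_left_mono)
  qed auto
  have lim_s: "(\<lambda>k. LINT y|lborel. f y * of_real (s k y)) \<longlonglongrightarrow> (LINT y|lborel. f y * of_real (R y))"
  proof (rule integral_dominated_convergence)
    show "integrable lborel (\<lambda>y. norm (f y) * C)"
      using f by simp
    have intR: "integrable lborel (\<lambda>x. indicator Q x * riesz_kernel (y - x))" for y
      using C(2)[of y]
      by (intro integrableI_bounded) (auto simp: kernels_nonneg intro: le_less_trans)
    show "AE y in lborel. (\<lambda>k. f y * of_real (s k y)) \<longlonglongrightarrow> f y * of_real (R y)"
    proof (intro AE_I2 tendsto_intros)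
      fix y :: "real ^ 'n"
      show "(\<lambda>k. s k y) \<longlonglongrightarrow> R y"
        unfolding s_def R_def
      proof (rule integral_dominated_convergence[OF _ _ intR[of y]])
        show "AE x in lborel. (\<lambda>k. indicator Q x * newton_reg (e k) (y - x)) \<longlonglongrightarrow> indicator Q x * riesz_kernel (y - x)"
          using ae[of y] by eventually_elim (intro tendsto_intros tendsto_newton_reg n e)
        show "AE x in lborel. norm (indicator Q x * newton_reg (e k) (y - x)) \<le> indicator Q x * riesz_kernel (y - x)" for k
          using ae[of y]
          by eventually_elim (auto simp: indicator_def kernels_nonneg intro!: newton_reg_le_riesz_kernel n)
      qed auto
    qed
    fix k
    have "\<bar>s k y\<bar> \<le> C" for y
    proof -
      have "ennreal (s k y) \<le> ennreal C"
        using Cn[of "e k" y] unfolding s_def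
        by (subst nn_integral_eq_integral[symmetric])
          (auto simp: kernels_nonneg intro!: integrableI_bounded intro: le_less_trans)
      moreover have "s k y \<ge> 0"
        unfolding s_def by (simp add: kernels_nonneg)
      ultimately show ?thesis using C(1) by simp
    qed
    then show "AE y in lborel. norm (f y * of_real (s k y)) \<le> norm (f y) * C"
      by (auto simp: norm_mult intro!: mult_left_mono)
  qed auto
  have "of_real c * (LINT y|lborel. u y * of_real (indicator Q y * M)) = - (LINT y|lborel. f y * of_real (R y))"
    using tendsto_mult[OF tendsto_const lim_u, of "of_real c"] tendsto_minus[OF lim_s]
    unfolding eq' by (rule LIMSEQ_unique)
  also have "(LINT y|lborel. f y * of_real (R y)) = (LINT x|lborel. indicator Q x *\<^sub>R w x)"
    unfolding R_def w_def by (subst kernel_Fubini(2)[OF f _ _ _ C(2)]) (auto simp: kernels_nonneg)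
  also have "(LINT y|lborel. u y * of_real (indicator Q y * M)) = of_real M * (LINT x|lborel. indicator Q x *\<^sub>R u x)"
  proof -
    have "(LINT y|lborel. u y * of_real (indicator Q y * M)) = (LINT x|lborel. of_real M * (indicator Q x *\<^sub>R u x))"
      by (intro Bochner_Integration.integral_cong refl) (simp add: scaleR_conv_of_real mult_ac)
    then show ?thesis
      by (simp only: integral_mult_right_zero)
  qed
  finally show "of_real (c * M) * (LINT x|lborel. indicator (box a b) x *\<^sub>R u x) =
      - (LINT x|lborel. indicator (box a b) x *\<^sub>R w x)"
    by (simp add: Q_def mult.assoc)
  show "integrable lborel (\<lambda>x. indicator (box a b) x *\<^sub>R w x)"
    unfolding w_def Q_def[symmetric]
    by (rule kernel_Fubini(1)[OF f _ _ _ C(2)]) (auto simp: kernels_nonneg)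
qed

text \<open>The function c M u + w has vanishing integral over every box. Since \<open>w\<close> is
  known to be integrable only over boxes, it is restricted to one box before
  \<open>AE_zero_if_box_integrals_zero\<close> is applied.\<close>

lemma newton_representation:
  fixes u f :: "real ^ 'n::finite \<Rightarrow> complex" and a b :: "real ^ 'n"
  assumes n: "CARD('n) \<ge> 2" and u: "integrable lborel u" and f: "integrable lborel f"
    and eq: "\<And>x e. e > 0 \<Longrightarrow> of_real c * (LINT y|lborel. u y * of_real (bump_kernel e (y - x))) =
      - (LINT y|lborel. f y * of_real (newton_reg e (y - x)))"
  defines "M \<equiv> LINT z|lborel. bump_kernel 1 (z :: real ^ 'n)"
  shows "AE x in lborel. x \<in> box a b \<longrightarrow>
    of_real (c * M) * u x = - (LINT y|lborel. f y * of_real (riesz_kernel (y - x)))"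
proof -
  define w where "w x = (LINT y|lborel. f y * of_real (riesz_kernel (y - x)))" for x
  have rep: "integrable lborel (\<lambda>x. indicator (box a' b') x *\<^sub>R w x)"
    "of_real (c * M) * (LINT x|lborel. indicator (box a' b') x *\<^sub>R u x) =
      - (LINT x|lborel. indicator (box a' b') x *\<^sub>R w x)" for a' b'
    unfolding M_def w_def using newton_representation_box[OF n u f eq] by blast+
  let ?h = "\<lambda>x. indicator (box a b) x *\<^sub>R (of_real (c * M) * u x + w x)"
  have iu: "integrable lborel (\<lambda>x. of_real (c * M) * (indicator (box a' b') x *\<^sub>R u x))" for a' b' :: "real ^ 'n"
    by (intro integrable_mult_right integrable_mult_indicator u) simp
  have h: "indicator (box a' b') x *\<^sub>R (of_real (c * M) * u x + w x) =
      of_real (c * M) * (indicator (box a' b') x *\<^sub>R u x) + indicator (box a' b') x *\<^sub>R w x" for a' b' x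
    by (simp add: algebra_simps)
  have zero: "(LINT x|lborel. indicator (box a' b') x *\<^sub>R (of_real (c * M) * u x + w x)) = 0" for a' b'
    unfolding h using rep[of a' b']
    by (subst Bochner_Integration.integral_add[OF iu]) (simp_all only: integral_mult_right_zero ab_left_minus)
  have "AE x in lborel. ?h x = 0"
  proof (rule AE_zero_if_box_integrals_zero)
    show "integrable lborel ?h"
      unfolding h using rep(1) iu by (intro Bochner_Integration.integrable_add)
    show "(LINT x|lborel. ?h x) = 0"
      by (rule zero)
    fix a' b' :: "real ^ 'n"
    \<comment> \<open>Intersections of boxes are boxes, so \<open>zero\<close> also covers the
      restricted function.\<close>
    obtain a'' b'' where "box a' b' \<inter> box a b = box a'' b''"
      unfolding box_Int_box by blast
    then have "indicator (box a' b') x *\<^sub>R ?h x = indicator (box a'' b'') x *\<^sub>R (of_real (c * M) * u x + w x)" for x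
      by (metis indicator_inter_arith scaleR_scaleR)
    then show "(LINT x|lborel. indicator (box a' b') x *\<^sub>R ?h x) = 0"
      by (simp only: zero)
  qed
  then show ?thesis
    unfolding w_def by eventually_elim (auto simp: indicator_def eq_neg_iff_add_eq_0)
qed

section \<open>Vanishing for small Kato norm\<close>

text \<open>The open sets in the definition of \<open>ess_support\<close> may be uncountably many.
  Lindelof leaves a countable subfamily with the same union, whose exceptional null sets can be
  united.\<close>

lemma AE_zero_outside_ess_support:
  fixes u :: "real ^ 'n::finite \<Rightarrow> complex"
  assumes "ess_support u \<subseteq> S"
  shows "AE x in lebesgue. x \<notin> S \<longrightarrow> u x = 0"
proof -
  let ?F = "{U. open U \<and> (AE x in lebesgue. x \<in> U \<longrightarrow> u x = 0)}"
  obtain F' where F': "F' \<subseteq> ?F" "countable F'" "\<Union>F' = \<Union>?F"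
    by (rule Lindelof[of ?F]) auto
  have ae: "AE x in lebesgue. \<forall>U\<in>F'. x \<in> U \<longrightarrow> u x = 0"
    using F'(1,2) by (subst AE_ball_countable) auto
  have cover: "- S \<subseteq> \<Union>F'"
    using assms unfolding F'(3) ess_support_def by blast
  from ae show ?thesis
    by eventually_elim (use cover in blast)
qed

lemma completion_ex_borel_measurable_complex:
  fixes g :: "'a \<Rightarrow> complex"
  assumes [measurable]: "g \<in> borel_measurable (completion M)"
  obtains g' where "g' \<in> borel_measurable M" "AE x in M. g x = g' x"
proof -
  have "(\<lambda>x. Re (g x)) \<in> borel_measurable (completion M)" "(\<lambda>x. Im (g x)) \<in> borel_measurable (completion M)"
    by measurable
  from this[THEN completion_ex_borel_measurable_real]
  obtain R I where [measurable]: "R \<in> borel_measurable M" "I \<in> borel_measurable M"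
    and "AE x in M. Re (g x) = R x" "AE x in M. Im (g x) = I x"
    by blast
  then have "AE x in M. g x = Complex (R x) (I x)"
    by (auto simp: complex_eq_iff)
  moreover have "(\<lambda>x. Complex (R x) (I x)) \<in> borel_measurable M"
    unfolding Complex_eq by measurable
  ultimately show thesis
    using that by blast
qed

text \<open>The outcome is c I <= H I with H < c, where I is the integral of |f|. Integrability of
  \<open>f\<close> makes I finite, which forces I = 0. Working in \<open>ennreal\<close> lets the
  integrals be exchanged by nonnegativity alone.\<close>

lemma kato_absorption:
  fixes u f V :: "real ^ 'n::finite \<Rightarrow> complex"
  assumes [measurable]: "u \<in> borel_measurable borel" "V \<in> borel_measurable borel" "B \<in> sets borel"
    and f: "integrable lborel f" and "c > 0"
    and rep: "AE x in lborel. x \<in> B \<longrightarrow>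
      c * norm (u x) \<le> norm (LINT y|lborel. f y * of_real (riesz_kernel (y - x)))"
    and dom: "AE x in lborel. norm (f x) \<le> norm (V x * u x)"
    and f0: "AE x in lborel. x \<notin> B \<longrightarrow> f x = 0"
    and kato: "\<And>y. y \<in> B \<Longrightarrow>
      (\<integral>\<^sup>+x. ennreal (indicator B x * norm (V x) * riesz_kernel (y - x)) \<partial>lborel) \<le> H"
    and "H < ennreal c"
  shows "AE x in lborel. f x = 0"
proof -
  have [measurable]: "f \<in> borel_measurable borel"
    using borel_measurable_integrable[OF f] by simp
  define I where "I = (\<integral>\<^sup>+x. ennreal (norm (f x)) \<partial>lborel)"
  have "I < \<infinity>"
    using f by (simp add: I_def integrable_iff_bounded)
  have pointwise: "AE x in lborel. ennreal c * ennreal (norm (f x)) \<le>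
      (\<integral>\<^sup>+y. ennreal (indicator B x * norm (V x)) * ennreal (norm (f y) * riesz_kernel (y - x)) \<partial>lborel)"
    using rep dom f0
  proof eventually_elim
    case (elim x)
    show ?case
    proof (cases "x \<in> B")
      case True
      let ?J = "\<integral>\<^sup>+y. ennreal (norm (f y) * riesz_kernel (y - x)) \<partial>lborel"
      \<comment> \<open>If the integrand is not integrable, the Bochner integral has the default
        value 0 and the bound is trivial.\<close>
      have "ennreal (norm (LINT y|lborel. f y * of_real (riesz_kernel (y - x)))) \<le>
          (\<integral>\<^sup>+y. ennreal (norm (f y * of_real (riesz_kernel (y - x)))) \<partial>lborel)"
        by (cases "integrable lborel (\<lambda>y. f y * of_real (riesz_kernel (y - x)))")
          (auto simp: integral_norm_bound_ennreal not_integrable_integral_eq)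
      also have "\<dots> = ?J"
        by (simp add: norm_mult kernels_nonneg)
      finally have J: "ennreal (c * norm (u x)) \<le> ?J"
        using elim(1) True by (meson ennreal_leI order_trans)
      have "c * norm (f x) \<le> c * norm (V x * u x)"
        using elim(2) \<open>c > 0\<close> by simp
      then have "ennreal c * ennreal (norm (f x)) \<le> ennreal (norm (V x)) * ennreal (c * norm (u x))"
        using \<open>c > 0\<close> by (simp add: norm_mult ennreal_mult'[symmetric] ennreal_leI mult_ac)
      also have "\<dots> \<le> ennreal (norm (V x)) * ?J"
        by (intro mult_left_mono J) simp
      also have "\<dots> = (\<integral>\<^sup>+y. ennreal (norm (V x)) * ennreal (norm (f y) * riesz_kernel (y - x)) \<partial>lborel)"
        by (rule nn_integral_cmult[symmetric]) measurable
      finally show ?thesis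
        using True by simp
    qed (use elim in simp)
  qed
  have "ennreal c * I = (\<integral>\<^sup>+x. ennreal c * ennreal (norm (f x)) \<partial>lborel)"
    unfolding I_def by (rule nn_integral_cmult[symmetric]) measurable
  also have "\<dots> \<le> (\<integral>\<^sup>+x. \<integral>\<^sup>+y. ennreal (indicator B x * norm (V x)) *
      ennreal (norm (f y) * riesz_kernel (y - x)) \<partial>lborel \<partial>lborel)"
    by (rule nn_integral_mono_AE[OF pointwise])
  also have "\<dots> = (\<integral>\<^sup>+y. \<integral>\<^sup>+x. ennreal (indicator B x * norm (V x)) *
      ennreal (norm (f y) * riesz_kernel (y - x)) \<partial>lborel \<partial>lborel)"
    by (rule lborel_pair.Fubini'[symmetric]) measurable
  also have "\<dots> = (\<integral>\<^sup>+y. ennreal (norm (f y)) *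
      (\<integral>\<^sup>+x. ennreal (indicator B x * norm (V x) * riesz_kernel (y - x)) \<partial>lborel) \<partial>lborel)"
    by (subst nn_integral_cmult[symmetric])
      (auto simp: kernels_nonneg ennreal_mult'[symmetric] mult_ac)
  also have "\<dots> \<le> (\<integral>\<^sup>+y. ennreal (norm (f y)) * H \<partial>lborel)"
  proof (rule nn_integral_mono_AE)
    \<comment> \<open>The Kato bound is available only for y in \<open>B\<close>; elsewhere
      \<open>f y\<close> is 0 almost everywhere.\<close>
    show "AE y in lborel. ennreal (norm (f y)) *
        (\<integral>\<^sup>+x. ennreal (indicator B x * norm (V x) * riesz_kernel (y - x)) \<partial>lborel)
        \<le> ennreal (norm (f y)) * H"
      using f0
    proof eventually_elim
      case (elim y)
      then show ?case
        by (cases "y \<in> B") (auto intro: mult_left_mono kato)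
    qed
  qed
  also have "\<dots> = H * I"
    unfolding I_def by (subst nn_integral_multc) (auto simp: mult.commute)
  finally have "\<not> H * I < ennreal c * I"
    by simp
  then have "I = 0"
    using ennreal_mult_strict_right_mono[OF \<open>H < ennreal c\<close>, of I] \<open>I < \<infinity>\<close>
    by (auto simp: zero_less_iff_neq_zero)
  then show ?thesis
    unfolding I_def by (subst (asm) nn_integral_0_iff_AE) auto
qed

lemma integrable_of_locally_integrable:
  fixes g :: "real ^ 'n::finite \<Rightarrow> complex"
  assumes "locally_integrable g" "AE x in lebesgue. x \<notin> ball a r \<longrightarrow> g x = 0"
  shows "integrable lebesgue g"
proof -
  have "integrable lebesgue (\<lambda>x. indicator (cball a r) x *\<^sub>R g x)"
    using assms(1) unfolding locally_integrable_def set_integrable_def by auto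
  moreover have "AE x in lebesgue. indicator (cball a r) x *\<^sub>R g x = g x"
    using assms(2) by eventually_elim (auto simp: indicator_def)
  ultimately show ?thesis
    using integrable_cong_AE_imp locally_integrable_measurable[OF assms(1)]
    by (metis (mono_tags, lifting) AE_cong)
qed

text \<open>Smallness is required at radius 2r because the ball about \<open>a\<close> must fit into
  a ball centred at any of its own points \<open>y\<close>, as in the Kato integral. The threshold
  is the constant of the potential representation.\<close>

lemma kato_solution_zero:
  fixes u V :: "real ^ 'n::finite \<Rightarrow> complex"
  assumes n: "CARD('n) \<ge> 3" and V: "locally_integrable V"
    and weak: "\<And>i. has_weak_deriv u [i, i] (w i)" and "r > 0"
    and u0: "AE x in lebesgue. x \<notin> ball a r \<longrightarrow> u x = 0"
    and dom: "AE x in lebesgue. norm (\<Sum>i\<in>UNIV. w i x) \<le> norm (V x * u x)"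
    and small: "(SUP x. \<integral>\<^sup>+ y\<in>ball x (2 * r).
        ennreal (norm (V y) / norm (x - y) ^ (CARD('n) - 2)) \<partial>lebesgue)
      < ennreal (real CARD('n) * (real CARD('n) - 2) * (LINT z|lborel. bump_kernel 1 (z :: real ^ 'n)))"
  shows "AE x in lebesgue. u x = 0"
proof -
  let ?n = "real CARD('n)" and ?B = "ball a r"
  define M where "M = (LINT z|lborel. bump_kernel 1 (z :: real ^ 'n))"
  define c where "c = ?n * (?n - 2) * M"
  define f where "f x = (\<Sum>i\<in>UNIV. w i x)" for x
  define H where "H = (SUP x. \<integral>\<^sup>+ y\<in>ball x (2 * r).
        ennreal (norm (V y) / norm (x - y) ^ (CARD('n) - 2)) \<partial>lebesgue)"
  have "c > 0"
    using n integral_bump_kernel_pos[where 'n = 'n] by (simp add: c_def M_def)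
  \<comment> \<open>Off the ball the differential inequality bounds |f| by |V u| = 0.\<close>
  have f0: "AE x in lebesgue. x \<notin> ?B \<longrightarrow> f x = 0"
    using u0 dom by eventually_elim (auto simp: f_def)
  have lu: "locally_integrable u" and lw: "locally_integrable (w i)" for i
    using weak by (auto simp: has_weak_deriv_def)
  have lf: "locally_integrable f"
    using lw unfolding locally_integrable_def f_def set_integrable_def scaleR_sum_right
    by (intro allI impI Bochner_Integration.integrable_sum) blast
  \<comment> \<open>Borel representatives move the problem from \<open>lebesgue\<close> to
    \<open>lborel\<close>, where the Fubini arguments take place.\<close>
  obtain u' where u': "u' \<in> borel_measurable lborel" "AE x in lborel. u x = u' x"
    using completion_ex_borel_measurable_complex[OF locally_integrable_measurable[OF lu]] .
  obtain f' where f': "f' \<in> borel_measurable lborel" "AE x in lborel. f x = f' x"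
    using completion_ex_borel_measurable_complex[OF locally_integrable_measurable[OF lf]] .
  obtain V' where V': "V' \<in> borel_measurable lborel" "AE x in lborel. V x = V' x"
    using completion_ex_borel_measurable_complex[OF locally_integrable_measurable[OF V]] .
  note [measurable] = u'(1) f'(1) V'(1) locally_integrable_measurable[OF lu] locally_integrable_measurable[OF lf]
  have borel: "u' \<in> borel_measurable borel" "f' \<in> borel_measurable borel" "V' \<in> borel_measurable borel"
    using u'(1) f'(1) V'(1) by simp_all
  have int: "integrable lborel g'" if "locally_integrable g" "AE x in lebesgue. x \<notin> ?B \<longrightarrow> g x = 0"
    "g' \<in> borel_measurable lborel" "AE x in lborel. g x = g' x" for g g' :: "real ^ 'n \<Rightarrow> complex"
  proof -
    have "integrable lebesgue g'"
      by (rule integrable_cong_AE_imp[OF integrable_of_locally_integrable[OF that(1,2)]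
            measurable_completion[OF that(3)] AE_completion[OF that(4)]])
    then show ?thesis
      using that(3) by (simp add: integrable_completion)
  qed
  have int_u: "integrable lborel u'" and int_f: "integrable lborel f'"
    by (rule int[OF lu u0 u'] int[OF lf f0 f'])+
  have transfer: "(LINT y|lebesgue. g y * of_real (k (y - x))) = (LINT y|lborel. g' y * of_real (k (y - x)))"
    if "locally_integrable g" "g' \<in> borel_measurable lborel" "AE x in lborel. g x = g' x"
      and [measurable]: "k \<in> borel_measurable borel"
    for g g' :: "real ^ 'n \<Rightarrow> complex" and k :: "real ^ 'n \<Rightarrow> real" and x
  proof -
    have [measurable]: "(\<lambda>y. complex_of_real (k (y - x))) \<in> borel_measurable lborel" "g' \<in> borel_measurable lborel"
      using that(2) by measurable
    have "(LINT y|lebesgue. g y * of_real (k (y - x))) = (LINT y|lebesgue. g' y * of_real (k (y - x)))"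
      using that(3) locally_integrable_measurable[OF that(1)]
      by (intro integral_cong_AE borel_measurable_times) (auto simp: AE_completion_iff intro: measurable_completion)
    also have "\<dots> = (LINT y|lborel. g' y * of_real (k (y - x)))"
      by (rule integral_completion) measurable
    finally show ?thesis .
  qed
  \<comment> \<open>For n >= 3 the factor n(2 - n) is negative; the sign is moved to the right so
    that \<open>c\<close> is positive.\<close>
  have eq: "of_real (?n * (?n - 2)) * (LINT y|lborel. u' y * of_real (bump_kernel e (y - x))) =
      - (LINT y|lborel. f' y * of_real (newton_reg e (y - x)))" if "e > 0" for e x
  proof -
    have "of_real (?n * (2 - ?n)) * (LINT y|lborel. u' y * of_real (bump_kernel e (y - x))) =
        (LINT y|lborel. f' y * of_real (newton_reg e (y - x)))"
      using weak_laplacian_newton_reg[OF weak \<open>r > 0\<close> that u0 f0[unfolded f_def], of x]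
      unfolding f_def[symmetric] transfer[OF lu u' borel_measurable_newton_reg(2)]
        transfer[OF lf f' borel_measurable_newton_reg(1)] .
    moreover have "?n * (?n - 2) = - (?n * (2 - ?n))"
      by (simp add: algebra_simps)
    ultimately show ?thesis
      by (simp only: of_real_minus mult_minus_left)
  qed
  obtain b1 b2 where box: "ball a r \<subseteq> box b1 b2"
    using bounded_subset_box_symmetric[OF bounded_ball] by blast
  have rep: "AE x in lborel. x \<in> ?B \<longrightarrow>
      c * norm (u' x) \<le> norm (LINT y|lborel. f' y * of_real (riesz_kernel (y - x)))"
    "AE x in lborel. x \<in> ?B \<longrightarrow>
      of_real c * u' x = - (LINT y|lborel. f' y * of_real (riesz_kernel (y - x)))"
  proof -
    have n2: "CARD('n) \<ge> 2"
      using n by simp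
    have ae: "AE x in lborel. x \<in> box b1 b2 \<longrightarrow>
        of_real c * u' x = - (LINT y|lborel. f' y * of_real (riesz_kernel (y - x)))"
      unfolding c_def M_def by (rule newton_representation[OF n2 int_u int_f eq])
    from ae show *: "AE x in lborel. x \<in> ?B \<longrightarrow>
        of_real c * u' x = - (LINT y|lborel. f' y * of_real (riesz_kernel (y - x)))"
      by eventually_elim (use box in auto)
    from * show "AE x in lborel. x \<in> ?B \<longrightarrow>
        c * norm (u' x) \<le> norm (LINT y|lborel. f' y * of_real (riesz_kernel (y - x)))"
    proof eventually_elim
      case (elim x)
      then have "x \<in> ?B \<Longrightarrow> norm (of_real c * u' x) = norm (LINT y|lborel. f' y * of_real (riesz_kernel (y - x)))"
        by simp
      then show ?case
        using \<open>c > 0\<close> by (simp add: norm_mult)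
    qed
  qed
  have f'0: "AE x in lborel. f' x = 0"
  proof (rule kato_absorption[OF borel(1,3) _ int_f \<open>c > 0\<close> rep(1)])
    show "AE x in lborel. norm (f' x) \<le> norm (V' x * u' x)"
      using dom[unfolded AE_completion_iff] f'(2) u'(2) V'(2)
      by eventually_elim (simp add: f_def)
    show "AE x in lborel. x \<notin> ?B \<longrightarrow> f' x = 0"
      using f0[unfolded AE_completion_iff] f'(2) by eventually_elim auto
    show "H < ennreal c"
      using small unfolding H_def c_def M_def .
    fix y assume y: "y \<in> ?B"
    have "(\<integral>\<^sup>+x. ennreal (indicator ?B x * norm (V' x) * riesz_kernel (y - x)) \<partial>lborel) =
        (\<integral>\<^sup>+x. ennreal (indicator ?B x * norm (V' x) * riesz_kernel (y - x)) \<partial>lebesgue)"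
      by (rule nn_integral_completion[symmetric])
    also have "\<dots> \<le> (\<integral>\<^sup>+x\<in>ball y (2 * r). ennreal (norm (V x) / norm (y - x) ^ (CARD('n) - 2)) \<partial>lebesgue)"
    proof (rule nn_integral_mono_AE)
      have sub: "?B \<subseteq> ball y (2 * r)"
      proof
        fix x assume "x \<in> ?B"
        then show "x \<in> ball y (2 * r)"
          using y dist_triangle[of y x a] by (simp add: dist_commute)
      qed
      show "AE x in lebesgue. ennreal (indicator ?B x * norm (V' x) * riesz_kernel (y - x))
          \<le> ennreal (norm (V x) / norm (y - x) ^ (CARD('n) - 2)) * indicator (ball y (2 * r)) x"
        using V'(2)[THEN AE_completion]
        by eventually_elim (use sub in \<open>auto simp: indicator_def riesz_kernel_def\<close>)
    qed
    also have "\<dots> \<le> H"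
      unfolding H_def by (rule SUP_upper) simp
    finally show "(\<integral>\<^sup>+x. ennreal (indicator ?B x * norm (V' x) * riesz_kernel (y - x)) \<partial>lborel) \<le> H" .
  qed simp
  have w0: "(LINT y|lborel. f' y * of_real (riesz_kernel (y - x))) = 0" for x
    using f'0 by (intro integral_eq_zero_AE) auto
  \<comment> \<open>On the ball the representation reads c u' = 0 with c > 0; off the ball
    \<open>u0\<close> applies.\<close>
  have "AE x in lborel. u x = 0"
    using rep(2) u'(2) u0[unfolded AE_completion_iff]
    by eventually_elim (use w0 \<open>c > 0\<close> in auto)
  then show ?thesis
    by (rule AE_completion)
qed

theorem corollary1p4:
  fixes V :: "real ^ 'n::finite \<Rightarrow> complex"
  assumes "CARD('n) \<ge> 3"
    and "V \<in> kato_class"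
  shows "\<exists>\<delta>>0. \<forall>(u :: real ^ 'n \<Rightarrow> complex) (a :: real ^ 'n) (r :: real).
           u \<in> sobolev_space 2 2 \<longrightarrow>
           \<not> (AE x in lebesgue. u x = 0) \<longrightarrow>
           (AE x in lebesgue. norm (weak_laplacian u x) \<le> norm (V x * u x)) \<longrightarrow>
           r > 0 \<longrightarrow>
           ess_support u \<subseteq> ball a r \<longrightarrow>
           measure lebesgue (ball a r) \<ge> \<delta>"
proof -
  let ?\<eta> = "\<lambda>r. SUP x. \<integral>\<^sup>+ y\<in>ball x r.
        ennreal (norm (V y) / norm (x - y) ^ (CARD('n) - 2)) \<partial>lebesgue"
  define c where "c = real CARD('n) * (real CARD('n) - 2) * (LINT z|lborel. bump_kernel 1 (z :: real ^ 'n))"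
  have "c > 0"
    using assms(1) integral_bump_kernel_pos[where 'n = 'n] by (simp add: c_def)
  have "(?\<eta> \<longlongrightarrow> 0) (at_right 0)" and V: "locally_integrable V"
    using assms(2) by (simp_all add: kato_class_def)
  \<comment> \<open>The radius \<open>\<rho>\<close> comes from the Kato limit of \<open>V\<close>
    and from \<open>c\<close>, which depends on the dimension alone; it is fixed before
    \<open>u\<close>, \<open>a\<close> and \<open>r\<close>.\<close>
  from order_tendstoD(2)[OF this(1), of "ennreal c"] \<open>c > 0\<close>
  obtain \<rho> where \<rho>: "\<rho> > 0" "\<And>s. 0 < s \<Longrightarrow> s < \<rho> \<Longrightarrow> ?\<eta> s < ennreal c"
    by (auto simp: eventually_at_right_field)
  have ball: "measure lebesgue (ball a r) = unit_ball_vol (real CARD('n)) * r ^ CARD('n)"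
    if "r \<ge> 0" for a :: "real ^ 'n" and r
    using content_ball[OF that, of a] by simp
  show ?thesis
  \<comment> \<open>The choice of \<open>\<delta>\<close> reflects that 2r < \<open>\<rho>\<close>
    would force u = 0 almost everywhere. Hence r is at least \<open>\<rho>\<close> / 2, and volumes
    of balls are monotone in the radius.\<close>
  proof (intro exI[of _ "measure lebesgue (ball (0 :: real ^ 'n) (\<rho> / 2))"] conjI allI impI)
    show "measure lebesgue (ball (0 :: real ^ 'n) (\<rho> / 2)) > 0"
      using \<rho>(1) by (subst ball) auto
    fix u :: "real ^ 'n \<Rightarrow> complex" and a :: "real ^ 'n" and r :: real
    assume u: "u \<in> sobolev_space 2 2" and nontrivial: "\<not> (AE x in lebesgue. u x = 0)"
      and dom: "AE x in lebesgue. norm (weak_laplacian u x) \<le> norm (V x * u x)"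
      and "r > 0" and supp: "ess_support u \<subseteq> ball a r"
    \<comment> \<open>Sobolev membership provides some weak derivative, so the choice made in
      \<open>weak_deriv\<close> is a genuine one.\<close>
    have weak: "has_weak_deriv u [i, i] (weak_deriv [i, i] u)" for i
    proof -
      have "\<exists>w. has_weak_deriv u [i, i] w"
        using u unfolding sobolev_space_def by force
      then show ?thesis
        unfolding weak_deriv_def by (rule someI_ex)
    qed
    have "\<not> ?\<eta> (2 * r) < ennreal c"
    proof
      assume "?\<eta> (2 * r) < ennreal c"
      then have "AE x in lebesgue. u x = 0"
        using kato_solution_zero[OF assms(1) V weak \<open>r > 0\<close> AE_zero_outside_ess_support[OF supp]] dom
        by (simp add: weak_laplacian_def c_def)
      with nontrivial show False by simp
    qed
    then have "\<rho> / 2 \<le> r"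
      using \<rho>(2)[of "2 * r"] \<open>r > 0\<close> by (cases "2 * r < \<rho>") auto
    then show "measure lebesgue (ball (0 :: real ^ 'n) (\<rho> / 2)) \<le> measure lebesgue (ball a r)"
      using \<rho>(1) \<open>r > 0\<close> by (subst (1 2) ball) (auto intro!: mult_left_mono power_mono)
  qed
qed

end
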